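(* Let $\mathcal{H}=L^2(\mathbb{R},m)$, where $m$ is Lebesgue measure, and let $X=B_0(1)=\{z\in\mathbb{C}:|z|\le 1\}$ be the closed unit disc with the usual metric $d(z,w)=|z-w|$. Let $P(X)$ be the collection of all projection-valued measures from the Borel subsets $\mathcal{B}(X)$ of $X$ into the projections on $\mathcal{H}$, equipped with the metric $$\rho(E,F)=\sup_{\phi\in \mathrm{Lip}_1(X)}\left\|\int\phi\,dE-\int\phi\,dF\right\|,$$ where $\|\cdot\|$ is the operator norm on $\mathcal{B}(\mathcal{H})$. Then the metric space $(P(X),\rho)$ is not compact.
   Context: $\mathcal{B}(\mathcal{H})$ denotes the bounded operators on the (complex) Hilbert space $\mathcal{H}$. A projection-valued measure $F:\mathcal{B}(X)\to\mathcal{B}(\mathcal{H})$ assigns to each Borel set an orthogonal projection, with $F(\emptyset)=0$, $F(X)=\mathrm{id}_{\mathcal{H}}$, $F(\Delta_1\cap\Delta_2)=F(\Delta_1)F(\Delta_2)$, and countable additivity (in the strong operator topology) on disjoint sequences of Borel sets. For $g,h\in\mathcal{H}$, $F_{g,h}(\Delta)=\langle F(\Delta)g,h\rangle$ is a countably additive complex measure. For a bounded Borel function $\psi:X\to\mathbb{C}$, $\int\psi\,dF$ is the unique bounded operator with $\langle(\int\psi\,dF)g,h\rangle=\int_X\psi\,dF_{g,h}$ for all $g,h\in\mathcal{H}$. $\mathrm{Lip}_1(X)=\{\phi:X\to\mathbb{R}: |\phi(x)-\phi(y)|\le d(x,y)\text{ for all }x,y\in X\}$. *)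

theory Defs
  imports "HOL-Analysis.Analysis"
begin

definition square_integrable :: "(real \<Rightarrow> complex) \<Rightarrow> bool" where
  "square_integrable f \<longleftrightarrow>
     f \<in> borel_measurable lebesgue \<and> integrable lebesgue (\<lambda>x. (cmod (f x))\<^sup>2)"

lemma square_integrable_zero: "square_integrable (\<lambda>x. 0)"
  by (simp add: square_integrable_def)

lemma square_integrable_scale:
  assumes "square_integrable f" shows "square_integrable (\<lambda>x. c * f x)"
  using assms by (auto simp: square_integrable_def norm_mult power_mult_distrib)

lemma square_integrable_add:
  assumes "square_integrable f" "square_integrable g"
  shows "square_integrable (\<lambda>x. f x + g x)"
proof -
  have [measurable]: "f \<in> borel_measurable lebesgue" "g \<in> borel_measurable lebesgue"
    using assms by (auto simp: square_integrable_def)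
  have "integrable lebesgue (\<lambda>x. 2 * (cmod (f x))\<^sup>2 + 2 * (cmod (g x))\<^sup>2)"
    using assms by (auto simp: square_integrable_def)
  moreover have "(cmod (f x + g x))\<^sup>2 \<le> 2 * (cmod (f x))\<^sup>2 + 2 * (cmod (g x))\<^sup>2" for x
  proof -
    have "(cmod (f x + g x))\<^sup>2 \<le> (cmod (f x) + cmod (g x))\<^sup>2"
      by (simp add: norm_triangle_ineq power_mono)
    also have "\<dots> \<le> 2 * (cmod (f x))\<^sup>2 + 2 * (cmod (g x))\<^sup>2"
      using sum_squares_bound[of "cmod (f x)" "cmod (g x)"] by (simp add: power2_sum)
    finally show ?thesis .
  qed
  ultimately have "integrable lebesgue (\<lambda>x. (cmod (f x + g x))\<^sup>2)"
    by (intro Bochner_Integration.integrable_bound[where g = "\<lambda>x. (cmod (f x + g x))\<^sup>2"]) auto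
  then show ?thesis by (simp add: square_integrable_def)
qed

lemma square_integrable_uminus:
  "square_integrable f \<Longrightarrow> square_integrable (\<lambda>x. - f x)"
  using square_integrable_scale[of f "-1"] by simp

lemma square_integrable_diff:
  assumes "square_integrable f" "square_integrable g"
  shows "square_integrable (\<lambda>x. f x - g x)"
  using square_integrable_add[OF assms(1) square_integrable_scale[OF assms(2), of "-1"]] by simp

lemma square_integrable_prod:
  assumes "square_integrable f" "square_integrable g"
  shows "integrable lebesgue (\<lambda>x. f x * cnj (g x))"
proof -
  have [measurable]: "f \<in> borel_measurable lebesgue" "g \<in> borel_measurable lebesgue"
    using assms by (auto simp: square_integrable_def)
  have m: "(\<lambda>x. f x * cnj (g x)) \<in> borel_measurable lebesgue"
    by (intro borel_measurable_times borel_measurable_continuous_on[where f = cnj]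
        continuous_on_cnj continuous_on_id) measurable
  have i: "integrable lebesgue (\<lambda>x. (cmod (f x))\<^sup>2 + (cmod (g x))\<^sup>2)"
    using assms by (auto simp: square_integrable_def)
  have "cmod (f x) * cmod (g x) \<le> (cmod (f x))\<^sup>2 + (cmod (g x))\<^sup>2" for x
    using sum_squares_bound[of "cmod (f x)" "cmod (g x)"]
      mult_nonneg_nonneg[OF norm_ge_zero norm_ge_zero, of "f x" "g x"] by linarith
  then show ?thesis
    by (intro Bochner_Integration.integrable_bound[OF i m]) (simp add: norm_mult)
qed

definition L2_rel :: "(real \<Rightarrow> complex) \<Rightarrow> (real \<Rightarrow> complex) \<Rightarrow> bool" where
  "L2_rel f g \<longleftrightarrow> square_integrable f \<and> square_integrable g \<and> (AE x in lebesgue. f x = g x)"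

lemma L2_rel_refl: "square_integrable f \<Longrightarrow> L2_rel f f"
  by (simp add: L2_rel_def)

lemma L2_rel_compose:
  assumes "L2_rel f f'" "square_integrable (\<lambda>x. H (f x))" "square_integrable (\<lambda>x. H (f' x))"
  shows "L2_rel (\<lambda>x. H (f x)) (\<lambda>x. H (f' x))"
proof -
  have "AE x in lebesgue. f x = f' x"
    using assms by (simp add: L2_rel_def)
  then have "AE x in lebesgue. H (f x) = H (f' x)"
    by (rule eventually_mono) simp
  then show ?thesis using assms by (simp add: L2_rel_def)
qed

lemma L2_rel_compose2:
  assumes "L2_rel f f'" "L2_rel g g'"
    "square_integrable (\<lambda>x. H (f x) (g x))" "square_integrable (\<lambda>x. H (f' x) (g' x))"
  shows "L2_rel (\<lambda>x. H (f x) (g x)) (\<lambda>x. H (f' x) (g' x))"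
proof -
  have "AE x in lebesgue. f x = f' x" "AE x in lebesgue. g x = g' x"
    using assms by (simp_all add: L2_rel_def)
  then have "AE x in lebesgue. H (f x) (g x) = H (f' x) (g' x)"
    by (rule eventually_elim2) simp
  then show ?thesis using assms by (simp add: L2_rel_def)
qed

lemma L2_rel_scale: "L2_rel f f' \<Longrightarrow> L2_rel (\<lambda>x. c * f x) (\<lambda>x. c * f' x)"
  by (rule L2_rel_compose[where H = "(*) c"]) (simp_all add: L2_rel_def square_integrable_scale)

lemma L2_relD: "L2_rel f g \<Longrightarrow> square_integrable f" "L2_rel f g \<Longrightarrow> square_integrable g"
  by (simp_all add: L2_rel_def)

quotient_type L2R = "real \<Rightarrow> complex" / partial: L2_rel
proof (rule part_equivpI)
  show "\<exists>f. L2_rel f f"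
    using square_integrable_zero L2_rel_refl by blast
  show "symp L2_rel"
    by (rule sympI) (simp add: L2_rel_def eq_commute)
  show "transp L2_rel"
  proof (rule transpI)
    fix f g h assume a: "L2_rel f g" "L2_rel g h"
    then have "AE x in lebesgue. f x = g x" "AE x in lebesgue. g x = h x"
      by (simp_all add: L2_rel_def)
    then have "AE x in lebesgue. f x = h x"
      by (rule eventually_elim2) simp
    then show "L2_rel f h" using a by (simp add: L2_rel_def)
  qed
qed

instantiation L2R :: real_vector
begin

lift_definition zero_L2R :: L2R is "\<lambda>x. 0"
  by (intro L2_rel_refl square_integrable_zero)

lift_definition plus_L2R :: "L2R \<Rightarrow> L2R \<Rightarrow> L2R" is "\<lambda>f g x. f x + g x"
  by (rule L2_rel_compose2[where H = "(+)"]) (simp_all add: L2_rel_def square_integrable_add)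

lift_definition uminus_L2R :: "L2R \<Rightarrow> L2R" is "\<lambda>f x. - f x"
  by (rule L2_rel_compose[where H = uminus]) (simp_all add: L2_rel_def square_integrable_uminus)

lift_definition minus_L2R :: "L2R \<Rightarrow> L2R \<Rightarrow> L2R" is "\<lambda>f g x. f x - g x"
  by (rule L2_rel_compose2[where H = "(-)"]) (simp_all add: L2_rel_def square_integrable_diff)

lift_definition scaleR_L2R :: "real \<Rightarrow> L2R \<Rightarrow> L2R" is "\<lambda>r f x. complex_of_real r * f x"
  by (intro L2_rel_scale)

instance
proof
  fix f g h :: L2R and r s :: real
  show "f + g + h = f + (g + h)"
    by transfer (simp add: L2_rel_def add.assoc square_integrable_add)
  show "f + g = g + f"
    by transfer (simp add: L2_rel_def add.commute square_integrable_add)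
  show "0 + f = f"
    by transfer (simp add: L2_rel_def)
  show "- f + f = 0"
    by transfer (simp add: L2_rel_def square_integrable_zero)
  show "f - g = f + - g"
    by transfer (simp add: L2_rel_def square_integrable_diff)
  show "r *\<^sub>R (f + g) = r *\<^sub>R f + r *\<^sub>R g"
    by transfer (simp add: L2_rel_def distrib_left square_integrable_add square_integrable_scale)
  show "(r + s) *\<^sub>R f = r *\<^sub>R f + s *\<^sub>R f"
    by transfer (simp add: L2_rel_def distrib_right square_integrable_add square_integrable_scale)
  show "r *\<^sub>R s *\<^sub>R f = (r * s) *\<^sub>R f"
    by transfer (simp add: L2_rel_def mult.assoc square_integrable_scale)
  show "1 *\<^sub>R f = f"
    by transfer (simp add: L2_rel_def)
qed

end

lift_definition cscale :: "complex \<Rightarrow> L2R \<Rightarrow> L2R" is "\<lambda>c f x. c * f x"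
  by (intro L2_rel_scale)

lift_definition cinner :: "L2R \<Rightarrow> L2R \<Rightarrow> complex"
  is "\<lambda>f g. \<integral>x. f x * cnj (g x) \<partial>lebesgue"
proof -
  fix f f' g g' :: "real \<Rightarrow> complex"
  assume f: "L2_rel f f'" and g: "L2_rel g g'"
  have i: "integrable lebesgue (\<lambda>x. f x * cnj (g x))" "integrable lebesgue (\<lambda>x. f' x * cnj (g' x))"
    using L2_relD[OF f] L2_relD[OF g] by (auto intro: square_integrable_prod)
  have "AE x in lebesgue. f x = f' x" "AE x in lebesgue. g x = g' x"
    using f g by (simp_all add: L2_rel_def)
  then have "AE x in lebesgue. f x * cnj (g x) = f' x * cnj (g' x)"
    by (rule eventually_elim2) simp
  then show "(\<integral>x. f x * cnj (g x) \<partial>lebesgue) = (\<integral>x. f' x * cnj (g' x) \<partial>lebesgue)"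
    using i by (intro integral_cong_AE borel_measurable_integrable)
qed

lemma cinner_add_left: "cinner (f + g) h = cinner f h + cinner g h"
  by transfer (simp add: L2_rel_def distrib_right square_integrable_prod)

lemma cinner_scale_left: "cinner (cscale c f) h = c * cinner f h"
  by transfer (simp add: mult.assoc)

lemma cinner_commute: "cinner f g = cnj (cinner g f)"
proof transfer
  fix f g :: "real \<Rightarrow> complex"
  have "(\<lambda>x. f x * cnj (g x)) = (\<lambda>x. cnj (g x * cnj (f x)))"
    by (simp add: mult.commute)
  then show "(\<integral>x. f x * cnj (g x) \<partial>lebesgue) = cnj (\<integral>x. g x * cnj (f x) \<partial>lebesgue)"
    by (simp only: Bochner_Integration.integral_cnj)
qed

lemma Re_cinner_self_integral:
  "Re (\<integral>x. f x * cnj (f x) \<partial>lebesgue) = (\<integral>x. (cmod (f x))\<^sup>2 \<partial>lebesgue)"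
proof -
  have "(\<lambda>x. f x * cnj (f x)) = (\<lambda>x. complex_of_real ((cmod (f x))\<^sup>2))"
    by (simp only: complex_norm_square)
  then show ?thesis
    by (simp only: integral_complex_of_real Re_complex_of_real)
qed

lemma cinner_self_nonneg: "Re (cinner f f) \<ge> 0"
  by transfer (simp only: Re_cinner_self_integral, simp)

lemma cinner_self_eq_0: "Re (cinner f f) = 0 \<longleftrightarrow> f = 0"
proof transfer
  fix f :: "real \<Rightarrow> complex"
  assume "L2_rel f f"
  then have f: "square_integrable f" by (rule L2_relD)
  then have i: "integrable lebesgue (\<lambda>x. (cmod (f x))\<^sup>2)"
    by (simp add: square_integrable_def)
  show "Re (\<integral>x. f x * cnj (f x) \<partial>lebesgue) = 0 \<longleftrightarrow>
    L2_rel f (\<lambda>x. 0)"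
    unfolding Re_cinner_self_integral L2_rel_def
    using integral_nonneg_eq_0_iff_AE[OF i] f square_integrable_zero by simp
qed

lemma scaleR_cscale: "r *\<^sub>R f = cscale (complex_of_real r) f"
  by transfer (intro L2_rel_refl square_integrable_scale, erule L2_relD)

text \<open>The real inner product is the real part of the complex one, so it induces the same
  norm.\<close>

instantiation L2R :: real_inner
begin

definition inner_L2R :: "L2R \<Rightarrow> L2R \<Rightarrow> real" where
  "inner_L2R f g = Re (cinner f g)"

definition norm_L2R :: "L2R \<Rightarrow> real" where
  "norm_L2R f = sqrt (Re (cinner f f))"

definition sgn_L2R :: "L2R \<Rightarrow> L2R" where
  "sgn_L2R f = inverse (norm f) *\<^sub>R f"

definition dist_L2R :: "L2R \<Rightarrow> L2R \<Rightarrow> real" where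
  "dist_L2R f g = norm (f - g)"

definition uniformity_L2R :: "(L2R \<times> L2R) filter" where
  "uniformity_L2R = (INF e\<in>{0<..}. principal {(f, g). dist f g < e})"

definition open_L2R :: "L2R set \<Rightarrow> bool" where
  "open_L2R U \<longleftrightarrow> (\<forall>f\<in>U. eventually (\<lambda>(f', g). f' = f \<longrightarrow> g \<in> U) uniformity)"

instance
proof
  fix f g h :: L2R and r :: real
  show "inner f g = inner g f"
    unfolding inner_L2R_def by (subst cinner_commute) simp
  show "inner (f + g) h = inner f h + inner g h"
    by (simp add: inner_L2R_def cinner_add_left)
  show "inner (r *\<^sub>R f) g = r * inner f g"
    by (simp add: inner_L2R_def scaleR_cscale cinner_scale_left)
  show "0 \<le> inner f f" "inner f f = 0 \<longleftrightarrow> f = 0"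
    by (simp_all add: inner_L2R_def cinner_self_nonneg cinner_self_eq_0)
  show "norm f = sqrt (inner f f)"
    by (simp add: norm_L2R_def inner_L2R_def)
qed (rule sgn_L2R_def dist_L2R_def uniformity_L2R_def open_L2R_def)+

end

text \<open>The type \<open>L2R \<Rightarrow>\<^sub>L L2R\<close> contains all bounded real-linear maps; its norm is the operator
  norm.\<close>

definition bounded_ops :: "(L2R \<Rightarrow>\<^sub>L L2R) set" where
  "bounded_ops = {T. \<forall>c g. blinfun_apply T (cscale c g) = cscale c (blinfun_apply T g)}"

definition orth_projections :: "(L2R \<Rightarrow>\<^sub>L L2R) set" where
  "orth_projections = {P \<in> bounded_ops. P o\<^sub>L P = P \<and>
     (\<forall>g h. cinner (blinfun_apply P g) h = cinner g (blinfun_apply P h))}"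

abbreviation borel_sets_on :: "'x::topological_space set \<Rightarrow> 'x set set" where
  "borel_sets_on X \<equiv> sets (restrict_space borel X)"

text \<open>\<open>\<rightarrow>\<^sub>E\<close> makes a measure \<open>undefined\<close> off the Borel sets of \<open>X\<close>, so that HOL equality of
  two measures is equality as functions on these sets.\<close>

definition pvms :: "'x::topological_space set \<Rightarrow> ('x set \<Rightarrow> (L2R \<Rightarrow>\<^sub>L L2R)) set" where
  "pvms X = {F \<in> borel_sets_on X \<rightarrow>\<^sub>E orth_projections.
     F {} = 0 \<and> F X = id_blinfun \<and>
     (\<forall>A\<in>borel_sets_on X. \<forall>B\<in>borel_sets_on X. F (A \<inter> B) = F A o\<^sub>L F B) \<and>
     (\<forall>A :: nat \<Rightarrow> 'x set. range A \<subseteq> borel_sets_on X \<longrightarrow> disjoint_family A \<longrightarrow>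
        (\<forall>g. (\<lambda>n. blinfun_apply (F (A n)) g) sums blinfun_apply (F (\<Union>n. A n)) g))}"

text \<open>Upper variation of a signed measure \<open>\<mu>\<close> on the measurable sets of \<open>M\<close>, that is, the
  positive part of its Jordan decomposition.  The negative part is the upper variation of
  \<open>-\<mu>\<close>.\<close>

definition upper_variation :: "'x measure \<Rightarrow> ('x set \<Rightarrow> real) \<Rightarrow> 'x measure" where
  "upper_variation M \<mu> = measure_of (space M) (sets M)
     (\<lambda>A. SUP B\<in>{B \<in> sets M. B \<subseteq> A}. ennreal (\<mu> B))"

definition signed_integral ::
    "'x measure \<Rightarrow> ('x set \<Rightarrow> real) \<Rightarrow> ('x \<Rightarrow> complex) \<Rightarrow> complex" where
  "signed_integral M \<mu> \<psi> =
     (\<integral>x. \<psi> x \<partial>upper_variation M \<mu>) - (\<integral>x. \<psi> x \<partial>upper_variation M (\<lambda>A. - \<mu> A))"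

definition complex_integral ::
    "'x measure \<Rightarrow> ('x set \<Rightarrow> complex) \<Rightarrow> ('x \<Rightarrow> complex) \<Rightarrow> complex" where
  "complex_integral M \<mu> \<psi> =
     signed_integral M (\<lambda>A. Re (\<mu> A)) \<psi> + \<i> * signed_integral M (\<lambda>A. Im (\<mu> A)) \<psi>"

definition pvm_integral ::
    "'x::topological_space set \<Rightarrow> ('x set \<Rightarrow> (L2R \<Rightarrow>\<^sub>L L2R)) \<Rightarrow> ('x \<Rightarrow> complex) \<Rightarrow>
     (L2R \<Rightarrow>\<^sub>L L2R)" where
  "pvm_integral X F \<psi> = (THE T. T \<in> bounded_ops \<and>
     (\<forall>g h. cinner (blinfun_apply T g) h =
        complex_integral (restrict_space borel X) (\<lambda>A. cinner (blinfun_apply (F A) g) h) \<psi>))"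

text \<open>The locale \<open>Metric_space\<close> constrains the distance function off the carrier as well,
  hence the case distinction.\<close>

definition pvm_dist ::
    "'x::metric_space set \<Rightarrow> ('x set \<Rightarrow> (L2R \<Rightarrow>\<^sub>L L2R)) \<Rightarrow> ('x set \<Rightarrow> (L2R \<Rightarrow>\<^sub>L L2R)) \<Rightarrow>
     real" where
  "pvm_dist X E F = (if E \<in> pvms X \<and> F \<in> pvms X then
     (SUP \<phi>\<in>{\<phi> :: 'x \<Rightarrow> real. 1-lipschitz_on X \<phi>}.
        norm (pvm_integral X E (\<lambda>x. complex_of_real (\<phi> x)) -
              pvm_integral X F (\<lambda>x. complex_of_real (\<phi> x))))
     else 0)"

end

theory Submission
  imports Defs
begin

text \<open>A bounded Borel function \<open>a \<le> \<phi> < b\<close> has the binary expansion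
  \<open>\<phi> = a + (b - a) * (\<Sum>k. 2^-(k+1) * 1_{D k})\<close>, so its integral is the operator
  \<open>a + (b - a) * (\<Sum>k. 2^-(k+1) * F (D k))\<close>, a norm convergent series because \<open>L\<^sup>2\<close> is complete.
  This bounds \<open>\<rho>\<close>, and \<open>\<rho>(E, F) = 0\<close> forces the scalar measures \<open>\<langle>E(\<cdot>)g, g\<rangle>\<close> and \<open>\<langle>F(\<cdot>)g, g\<rangle>\<close> to agree
  on closed sets, whence \<open>E = F\<close>.  For non-compactness, let \<open>P n\<close> be the projections onto the lines
  spanned by an orthonormal sequence; the two-point measures \<open>P n \<delta>\<^sub>x + (1 - P n) \<delta>\<^sub>y\<close> have pairwise
  distances at least \<open>d(x, y)\<close>, so they have no convergent subsequence.\<close>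

section \<open>Completeness of \<open>L\<^sup>2(\<real>)\<close>\<close>

lemma norm_abs_L2R:
  assumes "square_integrable f"
  shows "(norm (abs_L2R f))\<^sup>2 = (\<integral>x. (cmod (f x))\<^sup>2 \<partial>lebesgue)"
  using assms cinner_self_nonneg[of "abs_L2R f"]
  by (simp add: norm_L2R_def cinner.abs_eq L2_rel_refl Re_cinner_self_integral)

lemma nn_integral_norm_abs_L2R:
  assumes "square_integrable f"
  shows "(\<integral>\<^sup>+x. ennreal ((cmod (f x))\<^sup>2) \<partial>lebesgue) = ennreal ((norm (abs_L2R f))\<^sup>2)"
  using assms by (subst nn_integral_eq_integral) (auto simp: norm_abs_L2R square_integrable_def)

lemma abs_L2R_cases:
  obtains f where "square_integrable f" "u = abs_L2R f"
  using that[of "rep_L2R u"] Quotient_rep_reflp[OF Quotient_L2R, of u]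
    Quotient_abs_rep[OF Quotient_L2R, of u]
  by (simp add: L2_rel_def)

text \<open>Along a subsequence with increments below \<open>8^-k\<close> the series \<open>\<Sum>k. 4^k * d\<^sub>k\<^sup>2\<close> of the squared
  pointwise increments is integrable, so \<open>d\<^sub>k = O(2^-k)\<close> almost everywhere; Fatou's lemma then
  turns the pointwise limit into an \<open>L\<^sup>2\<close> limit.\<close>

lemma L2R_Cauchy_convergent:
  fixes u :: "nat \<Rightarrow> L2R"
  assumes "Cauchy u"
  shows "convergent u"
proof -
  have "\<forall>n. \<exists>f. square_integrable f \<and> u n = abs_L2R f"
    using abs_L2R_cases by blast
  from choice[OF this] obtain f where
    f: "\<And>n. square_integrable (f n)" "\<And>n. u n = abs_L2R (f n)"
    by auto
  have [measurable]: "f n \<in> borel_measurable lebesgue" for n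
    using f by (simp add: square_integrable_def)
  have diff: "(\<integral>\<^sup>+x. ennreal ((cmod (f m x - f n x))\<^sup>2) \<partial>lebesgue) = ennreal ((dist (u m) (u n))\<^sup>2)" for m n
    using nn_integral_norm_abs_L2R[OF square_integrable_diff[OF f(1) f(1)], of m n]
    by (simp add: dist_norm f minus_L2R.abs_eq L2_rel_refl)
  have "\<forall>k. \<exists>N. \<forall>m\<ge>N. \<forall>n\<ge>N. dist (u m) (u n) < (1/8)^k"
    using \<open>Cauchy u\<close> by (auto simp: Cauchy_def)
  from choice[OF this] obtain N where
    N: "\<And>k m n. m \<ge> N k \<Longrightarrow> n \<ge> N k \<Longrightarrow> dist (u m) (u n) < (1/8::real)^k"
    by auto
  \<comment> \<open>The summand \<open>k\<close> forces strict growth, and the sum of the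
    \<open>N i\<close> dominates \<open>N k\<close>.\<close>
  define r where "r k = k + (\<Sum>i\<le>k. N i)" for k
  have r: "strict_mono r"
    by (rule strict_monoI_Suc) (simp add: r_def)
  have rN: "N k \<le> r k" for k
    unfolding r_def using member_le_sum[of k "{..k}" N] by simp
  have "N k \<le> r (Suc k)" for k
    using rN[of k] strict_monoD[OF r, of k "Suc k"] by simp
  then have dr: "dist (u (r (Suc k))) (u (r k)) < (1/8)^k" for k
    using rN N by blast
  define d where "d k x = cmod (f (r (Suc k)) x - f (r k) x)" for k x
  have [measurable]: "d k \<in> borel_measurable lebesgue" for k
    unfolding d_def by measurable
  have bound: "(\<integral>\<^sup>+x. ennreal (4^k * (d k x)\<^sup>2) \<partial>lebesgue) \<le> ennreal ((1/2)^k)" for k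
  proof -
    have "(\<integral>\<^sup>+x. ennreal (4^k * (d k x)\<^sup>2) \<partial>lebesgue)
        = ennreal (4^k) * (\<integral>\<^sup>+x. ennreal ((d k x)\<^sup>2) \<partial>lebesgue)"
      by (subst nn_integral_cmult[symmetric]) (auto simp: ennreal_mult)
    also have "\<dots> = ennreal (4^k * (dist (u (r (Suc k))) (u (r k)))\<^sup>2)"
      unfolding d_def diff by (simp add: ennreal_mult)
    \<comment> \<open>A distance at most 1 dominates its square, so the bound \<open>(1/8)^k\<close>
      on the distance also bounds the square; the weight \<open>4^k\<close> then leaves the summable
      \<open>(1/2)^k\<close>.\<close>
    also have "\<dots> \<le> ennreal (4^k * (1/8)^k)"
    proof (intro ennreal_leI mult_left_mono)
      have "(dist (u (r (Suc k))) (u (r k)))\<^sup>2 \<le> dist (u (r (Suc k))) (u (r k))"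
      proof -
        have "dist (u (r (Suc k))) (u (r k)) \<le> 1"
          using dr[of k] power_le_one[of "1/8::real" k] by simp
        then show ?thesis
          using mult_left_le[of "dist (u (r (Suc k))) (u (r k))" "dist (u (r (Suc k))) (u (r k))"]
          by (simp add: power2_eq_square)
      qed
      then show "(dist (u (r (Suc k))) (u (r k)))\<^sup>2 \<le> (1/8)^k"
        using dr[of k] by simp
    qed simp
    also have "4^k * (1/8)^k = (1/2::real)^k"
      by (simp flip: power_mult_distrib)
    finally show ?thesis .
  qed
  have "(\<integral>\<^sup>+x. (\<Sum>k. ennreal (4^k * (d k x)\<^sup>2)) \<partial>lebesgue) =
      (\<Sum>k. \<integral>\<^sup>+x. ennreal (4^k * (d k x)\<^sup>2) \<partial>lebesgue)"
    by (rule nn_integral_suminf) measurable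
  also have "\<dots> \<le> (\<Sum>k. ennreal ((1/2)^k))"
    by (intro suminf_le bound) auto
  also have "\<dots> = ennreal (\<Sum>k. (1/2)^k)"
    by (rule suminf_ennreal2) (auto intro: summable_geometric)
  finally have "(\<integral>\<^sup>+x. (\<Sum>k. ennreal (4^k * (d k x)\<^sup>2)) \<partial>lebesgue) \<noteq> \<infinity>"
    by (auto simp: top_unique)
  then have "AE x in lebesgue. (\<Sum>k. ennreal (4^k * (d k x)\<^sup>2)) \<noteq> \<infinity>"
    by (rule nn_integral_PInf_AE[rotated]) measurable
  then have conv: "AE x in lebesgue. convergent (\<lambda>k. f (r k) x)"
  proof eventually_elim
    case (elim x)
    have "\<exists>C\<ge>0. z = ennreal C" if "z \<noteq> \<infinity>" for z :: ennreal
      using that by (cases z) auto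
    from this[OF elim] obtain C where
      C: "(\<Sum>k. ennreal (4^k * (d k x)\<^sup>2)) = ennreal C" "C \<ge> 0"
      by blast
    have "d k x \<le> sqrt C * (1/2)^k" for k
    proof (rule power2_le_imp_le)
      have "ennreal (4^k * (d k x)\<^sup>2) \<le> ennreal C"
        using sum_le_suminf[of "\<lambda>k. ennreal (4^k * (d k x)\<^sup>2)" "{k}"] C by simp
      then have "4^k * (d k x)\<^sup>2 \<le> C"
        using C by simp
      then show "(d k x)\<^sup>2 \<le> (sqrt C * (1/2)^k)\<^sup>2"
        using C power_mult[of "2::real" 2 k] power_mult[of "2::real" k 2]
        by (simp add: power_mult_distrib power_divide field_simps)
    qed (use C in simp)
    then have "\<And>k. norm (f (r (Suc k)) x - f (r k) x) \<le> sqrt C * (1/2)^k"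
      by (simp add: d_def)
    moreover have "summable (\<lambda>k. sqrt C * (1/2)^k)"
      by (intro summable_mult summable_geometric) simp
    ultimately have "summable (\<lambda>k. f (r (Suc k)) x - f (r k) x)"
      by (rule summable_comparison_test'[rotated, where N = 0])
    then have "convergent (\<lambda>n. f (r n) x - f (r 0) x)"
      using sum_lessThan_telescope[of "\<lambda>k. f (r k) x"] by (simp add: summable_iff_convergent)
    then show ?case
      using convergent_add[OF _ convergent_const[of "f (r 0) x"]] by fastforce
  qed
  define g where "g x = lim (\<lambda>k. f (r k) x)" for x
  have g_lim: "AE x in lebesgue. (\<lambda>k. f (r k) x) \<longlonglongrightarrow> g x"
    using conv by eventually_elim (simp add: g_def convergent_LIMSEQ_iff)
  have [measurable]: "g \<in> borel_measurable lebesgue"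
    unfolding g_def by measurable
  \<comment> \<open>Used twice: with \<open>e = 1\<close> it shows that the limit is square
    integrable, and with half the tolerance it gives convergence in norm.\<close>
  have close: "(\<integral>\<^sup>+x. ennreal ((cmod (f m x - g x))\<^sup>2) \<partial>lebesgue) \<le> ennreal (e\<^sup>2)"
    if "\<And>n. n \<ge> m \<Longrightarrow> dist (u m) (u n) \<le> e" for m e
  proof -
    have "(\<integral>\<^sup>+x. ennreal ((cmod (f m x - g x))\<^sup>2) \<partial>lebesgue)
      = (\<integral>\<^sup>+x. liminf (\<lambda>k. ennreal ((cmod (f m x - f (r k) x))\<^sup>2)) \<partial>lebesgue)"
    proof (rule nn_integral_cong_AE)
      show "AE x in lebesgue. ennreal ((cmod (f m x - g x))\<^sup>2)
        = liminf (\<lambda>k. ennreal ((cmod (f m x - f (r k) x))\<^sup>2))"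
        using g_lim
      proof eventually_elim
        case (elim x)
        then have "(\<lambda>k. ennreal ((cmod (f m x - f (r k) x))\<^sup>2)) \<longlonglongrightarrow> ennreal ((cmod (f m x - g x))\<^sup>2)"
          by (intro tendsto_ennrealI tendsto_intros)
        then show ?case
          by (intro lim_imp_Liminf[symmetric]) simp_all
      qed
    qed
    also have "\<dots> \<le> liminf (\<lambda>k. \<integral>\<^sup>+x. ennreal ((cmod (f m x - f (r k) x))\<^sup>2) \<partial>lebesgue)"
      by (rule nn_integral_liminf) measurable
    also have "\<dots> = liminf (\<lambda>k. ennreal ((dist (u m) (u (r k)))\<^sup>2))"
      by (simp add: diff)
    also have "\<dots> \<le> liminf (\<lambda>k. ennreal (e\<^sup>2))"
    proof (rule Liminf_mono)
      show "\<forall>\<^sub>F k in sequentially. ennreal ((dist (u m) (u (r k)))\<^sup>2) \<le> ennreal (e\<^sup>2)"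
        using eventually_ge_at_top[of m]
      proof eventually_elim
        case (elim k)
        then show ?case
          using that[of "r k"] seq_suble[OF r, of k] by (auto intro!: ennreal_leI power_mono)
      qed
    qed
    finally show ?thesis by (simp add: Liminf_const)
  qed
  have sq: "square_integrable (\<lambda>x. f m x - g x)"
    if "\<And>n. n \<ge> m \<Longrightarrow> dist (u m) (u n) \<le> e" for m e
    unfolding square_integrable_def
    using le_less_trans[OF close[OF that] ennreal_less_top]
    by (auto intro!: integrableI_bounded)
  obtain m0 where m0: "\<And>n. n \<ge> m0 \<Longrightarrow> dist (u m0) (u n) \<le> 1"
    using \<open>Cauchy u\<close>[unfolded Cauchy_def, rule_format, of 1] by (auto intro: less_imp_le)
  \<comment> \<open>\<open>g\<close> is recovered as \<open>f m0 - (f m0 - g)\<close>.\<close>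
  have g: "square_integrable g"
    using square_integrable_diff[OF f(1)[of m0] sq[OF m0]] by simp
  have "u \<longlonglongrightarrow> abs_L2R g"
  proof (rule metric_LIMSEQ_I)
    fix e :: real assume "e > 0"
    then obtain M where M: "\<And>m n. m \<ge> M \<Longrightarrow> n \<ge> M \<Longrightarrow> dist (u m) (u n) < e/2"
      using \<open>Cauchy u\<close>[unfolded Cauchy_def, rule_format, of "e/2"] by auto
    have "dist (u m) (abs_L2R g) < e" if "m \<ge> M" for m
    proof -
      have "\<And>n. n \<ge> m \<Longrightarrow> dist (u m) (u n) \<le> e/2"
        using M that by (simp add: less_imp_le)
      from close[OF this] sq[OF this]
      have "ennreal ((dist (u m) (abs_L2R g))\<^sup>2) \<le> ennreal ((e/2)\<^sup>2)"
        by (simp add: nn_integral_norm_abs_L2R dist_norm f g minus_L2R.abs_eq L2_rel_refl)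
      then have "(dist (u m) (abs_L2R g))\<^sup>2 \<le> (e/2)\<^sup>2"
        by simp
      then have "dist (u m) (abs_L2R g) \<le> e/2"
        by (rule power2_le_imp_le) (use \<open>e > 0\<close> in simp)
      then show ?thesis using \<open>e > 0\<close> by simp
    qed
    then show "\<exists>M. \<forall>m\<ge>M. dist (u m) (abs_L2R g) < e" by blast
  qed
  then show ?thesis by (rule convergentI)
qed

text \<open>Completeness passes to the space of bounded operators on \<open>L2R\<close>, where
  absolutely convergent operator series therefore have sums.\<close>

instance L2R :: banach
  by standard (rule L2R_Cauchy_convergent)

section \<open>Jordan decomposition\<close>

text \<open>The supremum is attained at \<open>A \<inter> Y\<close>: dropping the part of
  \<open>B\<close> outside the positive set \<open>Y\<close> does not decrease \<open>\<mu>\<close>,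
  and neither does adding the rest of \<open>A \<inter> Y\<close>. So the set function in
  \<open>upper_variation\<close> is countably additive, without which \<open>measure_of\<close>
  would yield the zero measure.\<close>

lemma upper_variation_Hahn:
  fixes \<mu> :: "'x set \<Rightarrow> real"
  assumes add: "\<And>A :: nat \<Rightarrow> 'x set. range A \<subseteq> sets M \<Longrightarrow> disjoint_family A \<Longrightarrow> (\<lambda>n. \<mu> (A n)) sums \<mu> (\<Union>n. A n)"
    and Y: "Y \<in> sets M" "\<And>A. A \<in> sets M \<Longrightarrow> A \<subseteq> Y \<Longrightarrow> 0 \<le> \<mu> A"
      "\<And>A. A \<in> sets M \<Longrightarrow> A \<inter> Y = {} \<Longrightarrow> \<mu> A \<le> 0"
    and A: "A \<in> sets M"
  shows "emeasure (upper_variation M \<mu>) A = ennreal (\<mu> (A \<inter> Y))"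
proof -
  have empty: "\<mu> {} = 0"
    using Y(2)[of "{}"] Y(3)[of "{}"] by simp
  have add2: "\<mu> (A \<union> B) = \<mu> A + \<mu> B" if "A \<in> sets M" "B \<in> sets M" "A \<inter> B = {}" for A B
  proof -
    have "disjoint_family (binaryset A B)"
      using that by (auto simp: disjoint_family_on_def binaryset_def)
    then have "(\<lambda>n. \<mu> (binaryset A B n)) sums \<mu> (A \<union> B)"
      using add[of "binaryset A B"] that by (auto simp: range_binaryset_eq UN_binaryset_eq)
    moreover have "(\<lambda>n. \<mu> (binaryset A B n)) sums (\<mu> A + \<mu> B)"
      by (rule binaryset_sums) (rule empty)
    ultimately show ?thesis by (rule sums_unique2)
  qed
  have Sup: "(SUP B\<in>{B \<in> sets M. B \<subseteq> A}. ennreal (\<mu> B)) = ennreal (\<mu> (A \<inter> Y))" if "A \<in> sets M" for A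
  proof (rule antisym)
    show "(SUP B\<in>{B \<in> sets M. B \<subseteq> A}. ennreal (\<mu> B)) \<le> ennreal (\<mu> (A \<inter> Y))"
    proof (intro SUP_least ennreal_leI, clarsimp)
      fix B assume B: "B \<in> sets M" "B \<subseteq> A"
      have "\<mu> B = \<mu> (B \<inter> Y) + \<mu> (B - Y)"
        using add2[of "B \<inter> Y" "B - Y"] B Y(1) by (auto simp: Int_Diff_Un)
      also have "\<dots> \<le> \<mu> (B \<inter> Y)"
        using Y(3)[of "B - Y"] B Y(1) by auto
      also have "\<dots> \<le> \<mu> (B \<inter> Y) + \<mu> ((A - B) \<inter> Y)"
        using Y(2)[of "(A - B) \<inter> Y"] B Y(1) that by auto
      also have "\<dots> = \<mu> ((B \<inter> Y) \<union> ((A - B) \<inter> Y))"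
        using B Y(1) that by (intro add2[symmetric]) auto
      also have "(B \<inter> Y) \<union> ((A - B) \<inter> Y) = A \<inter> Y"
        using B by auto
      finally show "\<mu> B \<le> \<mu> (A \<inter> Y)" .
    qed
    show "ennreal (\<mu> (A \<inter> Y)) \<le> (SUP B\<in>{B \<in> sets M. B \<subseteq> A}. ennreal (\<mu> B))"
      using that Y(1) by (intro SUP_upper) auto
  qed
  have ca: "countably_additive (sets M) (\<lambda>A. SUP B\<in>{B \<in> sets M. B \<subseteq> A}. ennreal (\<mu> B))"
  proof (rule countably_additiveI)
    fix A :: "nat \<Rightarrow> 'x set"
    assume A: "range A \<subseteq> sets M" "disjoint_family A" "(\<Union>n. A n) \<in> sets M"
    have "(\<lambda>n. \<mu> (A n \<inter> Y)) sums \<mu> (\<Union>n. A n \<inter> Y)"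
      using A Y(1) by (intro add) (auto simp: disjoint_family_on_def)
    then have "(\<lambda>n. ennreal (\<mu> (A n \<inter> Y))) sums ennreal (\<mu> ((\<Union>n. A n) \<inter> Y))"
      using A Y by (subst sums_ennreal) auto
    then show "(\<Sum>n. SUP B\<in>{B \<in> sets M. B \<subseteq> A n}. ennreal (\<mu> B)) =
        (SUP B\<in>{B \<in> sets M. B \<subseteq> (\<Union>n. A n)}. ennreal (\<mu> B))"
      using A by (subst (1 2) Sup) (auto simp: sums_iff)
  qed
  show ?thesis
    unfolding upper_variation_def
    by (subst emeasure_measure_of_sigma[OF sets.sigma_algebra_axioms _ ca A])
      (auto simp: Sup A positive_def empty)
qed

text \<open>\<open>N1\<close> and \<open>N2\<close> have a Hahn set \<open>Y\<close>. The previous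
  lemma, applied to \<open>Y\<close> and to its complement, makes \<open>U\<close> equal to
  \<open>\<mu>\<close> cut down to \<open>Y\<close> and \<open>L\<close> equal to
  \<open>- \<mu>\<close> cut down to the complement, so their difference restores
  \<open>\<mu>\<close>.\<close>

lemma Jordan_decomposition_upper_variation:
  fixes \<mu> :: "'x set \<Rightarrow> real"
  assumes N: "finite_measure N1" "finite_measure N2" "sets N1 = sets M" "sets N2 = sets M"
    and \<mu>: "\<And>A. A \<in> sets M \<Longrightarrow> \<mu> A = measure N1 A - measure N2 A"
  defines "U \<equiv> upper_variation M \<mu>" and "L \<equiv> upper_variation M (\<lambda>A. - \<mu> A)"
  shows "finite_measure U" "finite_measure L" "sets U = sets M" "sets L = sets M"
    "A \<in> sets M \<Longrightarrow> measure U A - measure L A = \<mu> A"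
proof -
  interpret N1: finite_measure N1 by fact
  interpret N2: finite_measure N2 by fact
  have "\<exists>Y\<in>sets N1. (\<forall>X\<in>sets N1. X \<subseteq> Y \<longrightarrow> N2 X \<le> N1 X) \<and>
      (\<forall>X\<in>sets N1. X \<inter> Y = {} \<longrightarrow> N1 X \<le> N2 X)"
    using N by (intro finite_unsigned_Hahn_decomposition) auto
  then obtain Y where Y: "Y \<in> sets M" "\<And>A. A \<in> sets M \<Longrightarrow> A \<subseteq> Y \<Longrightarrow> 0 \<le> \<mu> A"
      "\<And>A. A \<in> sets M \<Longrightarrow> A \<inter> Y = {} \<Longrightarrow> \<mu> A \<le> 0"
    using N by (auto simp: \<mu> N1.emeasure_eq_measure N2.emeasure_eq_measure)
  have add: "(\<lambda>n. \<mu> (A n)) sums \<mu> (\<Union>n. A n)"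
    if "range A \<subseteq> sets M" "disjoint_family A" for A :: "nat \<Rightarrow> 'x set"
  proof -
    have "(\<lambda>n. measure N1 (A n) - measure N2 (A n)) sums (measure N1 (\<Union>n. A n) - measure N2 (\<Union>n. A n))"
      using that N by (intro sums_diff N1.finite_measure_UNION N2.finite_measure_UNION) auto
    moreover have "\<mu> (\<Union>n. A n) = measure N1 (\<Union>n. A n) - measure N2 (\<Union>n. A n)"
      using that by (intro \<mu>) auto
    ultimately show ?thesis
      using that by (subst sums_cong[OF \<mu>]) auto
  qed
  have eU: "emeasure U A = ennreal (\<mu> (A \<inter> Y))" if "A \<in> sets M" for A
    unfolding U_def using add Y that by (intro upper_variation_Hahn) auto
  have eL: "emeasure L A = ennreal (- \<mu> (A \<inter> (space M - Y)))" if "A \<in> sets M" for A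
    unfolding L_def
  proof (rule upper_variation_Hahn)
    show "(\<lambda>n. - \<mu> (A n)) sums - \<mu> (\<Union>n. A n)"
      if "range A \<subseteq> sets M" "disjoint_family A" for A :: "nat \<Rightarrow> 'x set"
      using add[OF that] by (rule sums_minus)
    show "- \<mu> A \<le> 0" if "A \<in> sets M" "A \<inter> (space M - Y) = {}" for A
      using that Y(2)[of A] sets.sets_into_space[of A M] by auto
  qed (use Y that in auto)
  show s: "sets U = sets M" "sets L = sets M"
    by (auto simp: U_def L_def upper_variation_def sets.sets_measure_of_eq)
  then have sp: "space U = space M" "space L = space M"
    by (auto dest: sets_eq_imp_space_eq)
  show "finite_measure U" "finite_measure L"
    by (auto intro!: finite_measureI simp: sp eU eL)
  show "measure U A - measure L A = \<mu> A" if A: "A \<in> sets M"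
  proof -
    have "A \<inter> (space M - Y) = A - Y"
      using sets.sets_into_space[OF A] by auto
    moreover have "measure N1 A = measure N1 (A \<inter> Y) + measure N1 (A - Y)"
      "measure N2 A = measure N2 (A \<inter> Y) + measure N2 (A - Y)"
        using A Y N by (simp_all add: N1.finite_measure_Diff' N2.finite_measure_Diff')
    moreover have "0 \<le> \<mu> (A \<inter> Y)" "\<mu> (A - Y) \<le> 0"
      using A Y(1) by (auto intro!: Y(2,3))
    ultimately show ?thesis
      using A Y by (simp add: measure_def[of U] measure_def[of L] eU eL) (simp add: \<mu>)
  qed
qed

section \<open>Projection-valued measures\<close>

lemma cinner_scale_right: "cinner f (cscale c g) = cnj c * cinner f g"
  by (subst (1 2) cinner_commute) (simp add: cinner_scale_left)

text \<open>The second slot is conjugate linear, so \<open>inner f (cscale \<i> g)\<close> is the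
  real part of \<open>- \<i> * cinner f g\<close>, that is, the imaginary part of
  \<open>cinner f g\<close>. Complex statements thus reduce to pairs of real ones.\<close>

lemma cinner_eq_inner:
  "cinner f g = complex_of_real (inner f g) + \<i> * complex_of_real (inner f (cscale \<i> g))"
  by (simp add: inner_L2R_def cinner_scale_right complex_eq_iff)

lemma bounded_linear_cinner_left: "bounded_linear (\<lambda>f. cinner f h)"
  unfolding cinner_eq_inner
  by (intro bounded_linear_add bounded_linear_const_mult
      bounded_linear_compose[OF bounded_linear_of_real] bounded_linear_inner_left)

lemma cinner_ext:
  assumes "\<And>h. cinner f h = cinner g h"
  shows "f = g"
proof -
  have "inner (f - g) (f - g) = 0"
    using assms[of "f - g"] by (subst inner_diff_left) (simp add: inner_L2R_def)
  then show ?thesis by simp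
qed

lemma orth_projections_idem:
  "P \<in> orth_projections \<Longrightarrow> blinfun_apply P (blinfun_apply P g) = blinfun_apply P g"
  by (metis (mono_tags, lifting) blinfun_apply_blinfun_compose mem_Collect_eq orth_projections_def)

lemma orth_projections_inner:
  "P \<in> orth_projections \<Longrightarrow> inner (blinfun_apply P g) h = inner g (blinfun_apply P h)"
  by (simp add: orth_projections_def inner_L2R_def)

lemma orth_projections_inner_self:
  "P \<in> orth_projections \<Longrightarrow> inner (blinfun_apply P g) g = (norm (blinfun_apply P g))\<^sup>2"
  by (metis orth_projections_idem orth_projections_inner power2_norm_eq_inner)

lemma orth_projections_norm_le:
  assumes "P \<in> orth_projections"
  shows "norm P \<le> 1"
proof (rule norm_blinfun_bound)
  fix g
  have "norm (blinfun_apply P g) * norm (blinfun_apply P g) \<le> norm (blinfun_apply P g) * norm g"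
    using norm_cauchy_schwarz[of "blinfun_apply P g" g] orth_projections_inner_self[OF assms, of g]
    by (simp add: power2_eq_square)
  then show "norm (blinfun_apply P g) \<le> 1 * norm g"
    by (cases "norm (blinfun_apply P g) = 0") (auto dest: mult_left_le_imp_le)
qed simp

text \<open>Symmetry of the real form merges the two cross terms, so two squares suffice. Read for
  \<open>P = F A\<close> with \<open>A\<close> varying, it writes a signed measure as a difference
  of two positive ones.\<close>

lemma orth_projections_polarization:
  assumes "P \<in> orth_projections"
  shows "inner (blinfun_apply P g) h =
    inner (blinfun_apply P ((1/2) *\<^sub>R (g + h))) ((1/2) *\<^sub>R (g + h)) -
    inner (blinfun_apply P ((1/2) *\<^sub>R (g - h))) ((1/2) *\<^sub>R (g - h))"
  using orth_projections_inner[OF assms, of h g]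
  by (simp add: blinfun.bilinear_simps inner_simps inner_commute algebra_simps)

lemma orth_projections_eqI:
  assumes "P \<in> orth_projections" "Q \<in> orth_projections"
    and "\<And>g. inner (blinfun_apply P g) g = inner (blinfun_apply Q g) g"
  shows "P = Q"
proof (rule blinfun_eqI)
  fix g
  have "inner (blinfun_apply P g - blinfun_apply Q g) h = 0" for h
    using orth_projections_polarization[OF assms(1), of g h]
      orth_projections_polarization[OF assms(2), of g h]
    by (simp only: assms(3) inner_diff_left diff_self)
  from this[of "blinfun_apply P g - blinfun_apply Q g"]
  show "blinfun_apply P g = blinfun_apply Q g" by simp
qed

section \<open>Scalar measures of a projection-valued measure\<close>

lemma pvmsD:
  assumes "F \<in> pvms X"
  shows pvms_projection: "\<And>A. A \<in> borel_sets_on X \<Longrightarrow> F A \<in> orth_projections"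
    and pvms_empty: "F {} = 0"
    and pvms_space: "F X = id_blinfun"
    and pvms_sums: "\<And>A g. range A \<subseteq> borel_sets_on X \<Longrightarrow> disjoint_family A \<Longrightarrow>
      (\<lambda>n. blinfun_apply (F (A n)) g) sums blinfun_apply (F (\<Union>n. A n)) g"
  using assms by (auto simp: pvms_def)

lemma carrier_in_borel_sets_on [simp]: "X \<in> borel_sets_on X"
  using sets.top[of "restrict_space borel X"] by (simp add: space_restrict_space)

text \<open>For a projection the real inner product is a squared norm and equals the complex one, so
  \<open>ennreal\<close> truncates nothing.\<close>

definition spectral_measure ::
    "'x::topological_space set \<Rightarrow> ('x set \<Rightarrow> (L2R \<Rightarrow>\<^sub>L L2R)) \<Rightarrow> L2R \<Rightarrow> 'x measure" where
  "spectral_measure X F g =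
     measure_of X (borel_sets_on X) (\<lambda>A. ennreal (inner (blinfun_apply (F A) g) g))"

lemma sets_spectral_measure [simp, measurable_cong]:
    "sets (spectral_measure X F g) = borel_sets_on X"
  and space_spectral_measure [simp]: "space (spectral_measure X F g) = X"
proof -
  have "borel_sets_on X \<subseteq> Pow X"
    using sets.space_closed[of "restrict_space borel X"] by (simp add: space_restrict_space)
  moreover have "sigma_sets X (borel_sets_on X) = borel_sets_on X"
    using sets.sigma_sets_eq[of "restrict_space borel X"] by (simp add: space_restrict_space)
  ultimately show "sets (spectral_measure X F g) = borel_sets_on X"
    "space (spectral_measure X F g) = X"
    by (simp_all add: spectral_measure_def)
qed

lemma emeasure_spectral_measure:
  assumes F: "F \<in> pvms X" and A: "A \<in> borel_sets_on X"
  shows "emeasure (spectral_measure X F g) A = ennreal (inner (blinfun_apply (F A) g) g)"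
  unfolding spectral_measure_def
proof (rule emeasure_measure_of_sigma[OF _ _ _ A])
  show "sigma_algebra X (borel_sets_on X)"
    using sets.sigma_algebra_axioms[of "restrict_space borel X"] by (simp add: space_restrict_space)
  show "positive (borel_sets_on X) (\<lambda>A. ennreal (inner (blinfun_apply (F A) g) g))"
    by (simp add: positive_def pvms_empty[OF F])
  show "countably_additive (borel_sets_on X) (\<lambda>A. ennreal (inner (blinfun_apply (F A) g) g))"
  proof (rule countably_additiveI)
    fix A :: "nat \<Rightarrow> 'a set"
    assume A: "range A \<subseteq> borel_sets_on X" "disjoint_family A" "(\<Union>n. A n) \<in> borel_sets_on X"
    have nn: "0 \<le> inner (blinfun_apply (F B) g) g" if "B \<in> borel_sets_on X" for B
      using orth_projections_inner_self[OF pvms_projection[OF F that]] by simp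
    have "(\<lambda>n. inner (blinfun_apply (F (A n)) g) g) sums inner (blinfun_apply (F (\<Union>n. A n)) g) g"
      by (rule bounded_linear.sums[OF bounded_linear_inner_left pvms_sums[OF F A(1,2)]])
    then have "(\<lambda>n. ennreal (inner (blinfun_apply (F (A n)) g) g)) sums
        ennreal (inner (blinfun_apply (F (\<Union>n. A n)) g) g)"
      using A nn by (subst sums_ennreal) auto
    then show "(\<Sum>n. ennreal (inner (blinfun_apply (F (A n)) g) g)) =
        ennreal (inner (blinfun_apply (F (\<Union>n. A n)) g) g)"
      by (simp add: sums_iff)
  qed
qed

lemma measure_spectral_measure:
  assumes "F \<in> pvms X" "A \<in> borel_sets_on X"
  shows "measure (spectral_measure X F g) A = inner (blinfun_apply (F A) g) g"
  using emeasure_spectral_measure[OF assms]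
    orth_projections_inner_self[OF pvms_projection[OF assms]]
  by (simp add: measure_def)

lemma finite_spectral_measure:
  "F \<in> pvms X \<Longrightarrow> finite_measure (spectral_measure X F g)"
  by (rule finite_measureI) (simp add: emeasure_spectral_measure)

section \<open>Integration by binary digits\<close>

definition digit_set :: "'x set \<Rightarrow> ('x \<Rightarrow> real) \<Rightarrow> nat \<Rightarrow> 'x set" where
  "digit_set X \<phi> k = {x \<in> X. odd \<lfloor>2 ^ Suc k * \<phi> x\<rfloor>}"

text \<open>The parity of \<open>\<lfloor>2 ^ Suc k * y\<rfloor>\<close> is binary digit number
  \<open>Suc k\<close> of \<open>y\<close>. The first \<open>n\<close> digits sum to
  \<open>\<lfloor>2 ^ n * y\<rfloor> / 2 ^ n\<close>, which falls short of \<open>y\<close> by less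
  than \<open>(1/2) ^ n\<close>.\<close>

lemma binary_expansion_sums:
  fixes y :: real
  assumes "0 \<le> y" "y < 1"
  shows "(\<lambda>k. (1/2) ^ Suc k * of_bool (odd \<lfloor>2 ^ Suc k * y\<rfloor>)) sums y"
proof -
  \<comment> \<open>Doubling appends one binary digit to the integer part, namely the parity of the
    new integer part.\<close>
  have step: "of_int \<lfloor>2 * z\<rfloor> = 2 * of_int \<lfloor>z\<rfloor> + (of_bool (odd \<lfloor>2 * z\<rfloor>) :: real)" for z :: real
  proof -
    have "\<lfloor>2 * z\<rfloor> = 2 * \<lfloor>z\<rfloor> \<or> \<lfloor>2 * z\<rfloor> = 2 * \<lfloor>z\<rfloor> + 1" by linarith
    then show ?thesis by auto
  qed
  have sum: "(\<Sum>k<n. (1/2::real) ^ Suc k * of_bool (odd \<lfloor>2 ^ Suc k * y\<rfloor>)) = of_int \<lfloor>2 ^ n * y\<rfloor> / 2 ^ n" for n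
  proof (induction n)
    case 0
    have "\<lfloor>y\<rfloor> = 0" using assms by (simp add: floor_eq_iff)
    then show ?case by simp
  next
    case (Suc n)
    then show ?case
      using step[of "2 ^ n * y"] by (simp add: field_simps power_one_over)
  qed
  have "(\<lambda>n. of_int \<lfloor>2 ^ n * y\<rfloor> / 2 ^ n) \<longlonglongrightarrow> y"
  proof (rule tendsto_sandwich[OF _ _ _ tendsto_const])
    show "\<forall>\<^sub>F n in sequentially. y - (1/2) ^ n \<le> of_int \<lfloor>2 ^ n * y\<rfloor> / 2 ^ n"
    proof (rule always_eventually, rule allI)
      fix n
      have "2 ^ n * y - 1 \<le> of_int \<lfloor>2 ^ n * y\<rfloor>" by linarith
      then show "y - (1/2) ^ n \<le> of_int \<lfloor>2 ^ n * y\<rfloor> / 2 ^ n"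
        using divide_right_mono[of "2 ^ n * y - 1" "of_int \<lfloor>2 ^ n * y\<rfloor>" "2 ^ n"]
        by (simp add: diff_divide_distrib power_one_over)
    qed
    show "\<forall>\<^sub>F n in sequentially. of_int \<lfloor>2 ^ n * y\<rfloor> / 2 ^ n \<le> y"
      by (rule always_eventually) (simp add: field_simps)
    have "(\<lambda>n. y - (1/2) ^ n) \<longlonglongrightarrow> y - 0"
      by (intro tendsto_diff tendsto_const LIMSEQ_realpow_zero) auto
    then show "(\<lambda>n. y - (1/2) ^ n) \<longlonglongrightarrow> y" by simp
  qed
  then show ?thesis by (simp only: sums_def sum)
qed

lemma digit_set_sums:
  assumes "0 \<le> \<phi> x" "\<phi> x < 1" "x \<in> X"
  shows "(\<lambda>k. (1/2) ^ Suc k * indicat_real (digit_set X \<phi> k) x) sums \<phi> x"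
proof -
  have "indicat_real (digit_set X \<phi> k) x = of_bool (odd \<lfloor>2 ^ Suc k * \<phi> x\<rfloor>)" for k
    using assms by (simp add: digit_set_def indicator_def)
  then show ?thesis
    using binary_expansion_sums[OF assms(1,2)] by simp
qed

lemma digit_set_measurable:
  assumes [measurable]: "\<phi> \<in> borel_measurable M"
  shows "digit_set (space M) \<phi> k \<in> sets M"
  unfolding digit_set_def by measurable

lemma summable_halves: "summable (\<lambda>k. (1/2::real) ^ Suc k * c)"
  by (intro summable_mult2) (simp add: summable_Suc_iff[of "\<lambda>k. (1/2::real) ^ k"] del: power_Suc)

text \<open>The expansion may be integrated term by term because the norms of the terms are
  dominated by a geometric series times the total mass.\<close>

lemma integral_digit_set_sums:
  assumes "finite_measure M" and [measurable]: "\<phi> \<in> borel_measurable M"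
    and \<phi>: "\<And>x. x \<in> space M \<Longrightarrow> 0 \<le> \<phi> x \<and> \<phi> x < 1"
  shows "(\<lambda>k. (1/2) ^ Suc k * measure M (digit_set (space M) \<phi> k)) sums (\<integral>x. \<phi> x \<partial>M)"
proof -
  interpret finite_measure M by fact
  let ?D = "digit_set (space M) \<phi>"
  have [measurable]: "?D k \<in> sets M" for k
    by (rule digit_set_measurable) measurable
  have int: "(\<integral>x. (1/2) ^ Suc k * indicat_real (?D k) x \<partial>M) = (1/2) ^ Suc k * measure M (?D k)" for k
    by simp
  have "(\<lambda>k. \<integral>x. (1/2) ^ Suc k * indicat_real (?D k) x \<partial>M) sums
      (\<integral>x. (\<Sum>k. (1/2) ^ Suc k * indicat_real (?D k) x) \<partial>M)"
  proof (rule sums_integral)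
    show "integrable M (\<lambda>x. (1/2) ^ Suc k * indicat_real (?D k) x)" for k
      by (intro integrable_mult_right integrable_real_indicator) (auto simp: emeasure_eq_measure)
    show "AE x in M. summable (\<lambda>k. norm ((1/2) ^ Suc k * indicat_real (?D k) x))"
      by (rule AE_I2, rule summable_comparison_test'[OF summable_halves[of 1], of 0]) (simp add: indicator_def)
    show "summable (\<lambda>k. \<integral>x. norm ((1/2) ^ Suc k * indicat_real (?D k) x) \<partial>M)"
      by (rule summable_comparison_test'[OF summable_halves[of "measure M (space M)"], of 0])
        (simp add: bounded_measure)
  qed
  moreover have "(\<integral>x. (\<Sum>k. (1/2) ^ Suc k * indicat_real (?D k) x) \<partial>M) = (\<integral>x. \<phi> x \<partial>M)"
    using \<phi> by (intro Bochner_Integration.integral_cong sums_unique[symmetric] digit_set_sums) auto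
  ultimately show ?thesis by (simp only: int)
qed

text \<open>The affine normalisation brings the values into \<open>[0, 1)\<close>, where the binary
  expansion applies.\<close>

lemma lebesgue_integral_scale_shift:
  fixes \<phi> :: "'x \<Rightarrow> real"
  assumes "finite_measure M" and [measurable]: "\<phi> \<in> borel_measurable M"
    and \<phi>: "\<And>x. x \<in> space M \<Longrightarrow> a \<le> \<phi> x \<and> \<phi> x < b" and "a < b"
  shows "(\<integral>x. \<phi> x \<partial>M) = a * measure M (space M) + (b - a) * (\<integral>x. (\<phi> x - a) / (b - a) \<partial>M)"
proof -
  interpret finite_measure M by fact
  have "integrable M \<phi>"
    by (rule integrable_const_bound[of _ "\<bar>a\<bar> + \<bar>b\<bar>"]) (use \<phi> in \<open>auto intro!: AE_I2 dest: \<phi>\<close>)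
  then have "(\<integral>x. (\<phi> x - a) / (b - a) \<partial>M) = ((\<integral>x. \<phi> x \<partial>M) - a * measure M (space M)) / (b - a)"
    by simp
  then show ?thesis
    using \<open>a < b\<close> by simp
qed

section \<open>The operator integral as a norm convergent series\<close>

definition dyadic_op ::
    "'x set \<Rightarrow> ('x set \<Rightarrow> (L2R \<Rightarrow>\<^sub>L L2R)) \<Rightarrow> real \<Rightarrow> real \<Rightarrow> ('x \<Rightarrow> real) \<Rightarrow> (L2R \<Rightarrow>\<^sub>L L2R)" where
  "dyadic_op X F a b \<phi> = a *\<^sub>R id_blinfun +
     (b - a) *\<^sub>R (\<Sum>k. (1/2) ^ Suc k *\<^sub>R F (digit_set X (\<lambda>x. (\<phi> x - a) / (b - a)) k))"

context
  fixes X :: "'x::topological_space set" and F a b \<phi> D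
  assumes F: "F \<in> pvms X"
    and \<phi>_meas: "\<phi> \<in> borel_measurable (restrict_space borel X)"
    and \<phi>_bounds: "\<And>x. x \<in> X \<Longrightarrow> a \<le> \<phi> x \<and> \<phi> x < b"
    and "a < b"
  defines "D \<equiv> digit_set X (\<lambda>x. (\<phi> x - a) / (b - a))"
begin

lemma digit_set_borel: "D k \<in> borel_sets_on X"
proof -
  note [measurable] = \<phi>_meas
  have "digit_set (space (restrict_space borel X)) (\<lambda>x. (\<phi> x - a) / (b - a)) k \<in> borel_sets_on X"
    by (rule digit_set_measurable) measurable
  then show ?thesis by (simp add: D_def space_restrict_space)
qed

lemma norm_digit_term: "norm ((1/2) ^ Suc k *\<^sub>R F (D k)) \<le> (1/2) ^ Suc k"
  using mult_left_mono[OF orth_projections_norm_le[OF pvms_projection[OF F digit_set_borel[of k]]],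
      of "(1/2) ^ Suc k"]
  by simp

lemma summable_digit_terms: "summable (\<lambda>k. (1/2) ^ Suc k *\<^sub>R F (D k))"
  by (rule summable_comparison_test'[where N = 0, OF _ norm_digit_term])
    (use summable_halves[of 1] in simp)

text \<open>The series converges in operator norm, so a bounded linear map acts on it term by term.
  Taking for \<open>f\<close> a matrix coefficient turns it into a scalar digit series.\<close>

lemma bounded_linear_dyadic_op:
  fixes f :: "(L2R \<Rightarrow>\<^sub>L L2R) \<Rightarrow> 'b::real_normed_vector"
  assumes "bounded_linear f"
  shows "f (dyadic_op X F a b \<phi>) =
    a *\<^sub>R f id_blinfun + (b - a) *\<^sub>R (\<Sum>k. (1/2) ^ Suc k *\<^sub>R f (F (D k)))"
    and "summable (\<lambda>k. (1/2) ^ Suc k *\<^sub>R f (F (D k)))"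
proof -
  interpret f: bounded_linear f by fact
  show "f (dyadic_op X F a b \<phi>) =
    a *\<^sub>R f id_blinfun + (b - a) *\<^sub>R (\<Sum>k. (1/2) ^ Suc k *\<^sub>R f (F (D k)))"
    unfolding dyadic_op_def D_def[symmetric]
    by (simp only: f.add f.scaleR f.suminf[OF summable_digit_terms])
  show "summable (\<lambda>k. (1/2) ^ Suc k *\<^sub>R f (F (D k)))"
    using f.summable[OF summable_digit_terms] by (simp only: f.scaleR)
qed

text \<open>The scalar counterpart of \<open>dyadic_op\<close>, over the same digit sets, so that
  operator and integral can be compared term by term. Summability is what allows two such series to
  be subtracted.\<close>

lemma integral_eq_digits:
  assumes "finite_measure M" "sets M = borel_sets_on X"
  shows "(\<integral>x. \<phi> x \<partial>M) = a * measure M X + (b - a) * (\<Sum>k. (1/2) ^ Suc k * measure M (D k))"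
    and "summable (\<lambda>k. (1/2) ^ Suc k * measure M (D k))"
proof -
  have sp: "space M = X"
    using sets_eq_imp_space_eq[OF assms(2)] by (simp add: space_restrict_space)
  have [measurable]: "\<phi> \<in> borel_measurable M"
    using \<phi>_meas measurable_cong_sets[OF assms(2) refl] by blast
  have "(\<lambda>k. (1/2) ^ Suc k * measure M (D k)) sums (\<integral>x. (\<phi> x - a) / (b - a) \<partial>M)"
    using integral_digit_set_sums[OF assms(1), of "\<lambda>x. (\<phi> x - a) / (b - a)"] \<phi>_bounds \<open>a < b\<close>
    by (simp add: sp D_def)
  then show "summable (\<lambda>k. (1/2) ^ Suc k * measure M (D k))"
    and "(\<integral>x. \<phi> x \<partial>M) = a * measure M X + (b - a) * (\<Sum>k. (1/2) ^ Suc k * measure M (D k))"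
    using lebesgue_integral_scale_shift[OF assms(1), of \<phi> a b] \<phi>_bounds \<open>a < b\<close>
    by (auto simp: sums_iff sp)
qed

lemma bounded_linear_apply_inner:
  "bounded_linear (\<lambda>T :: L2R \<Rightarrow>\<^sub>L L2R. inner (blinfun_apply T g) h)"
  by (rule bounded_linear_compose[OF bounded_linear_inner_left blinfun.bounded_linear_left])

lemma inner_dyadic_op_spectral_measure:
  "inner (blinfun_apply (dyadic_op X F a b \<phi>) g) g = (\<integral>x. \<phi> x \<partial>spectral_measure X F g)"
proof -
  have "measure (spectral_measure X F g) X = inner g g"
    by (simp add: measure_spectral_measure[OF F] pvms_space[OF F])
  then show ?thesis
    using bounded_linear_dyadic_op(1)[OF bounded_linear_apply_inner, of g g]
      integral_eq_digits(1)[OF finite_spectral_measure[OF F] sets_spectral_measure, of g]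
    by (simp add: measure_spectral_measure[OF F] digit_set_borel)
qed

text \<open>Polarization writes the signed measure as a difference of two spectral measures, so its
  variations \<open>U\<close> and \<open>L\<close> are finite with difference \<open>?\<mu>\<close>.
  Subtracting their digit series leaves the digit series of \<open>?\<mu>\<close>, which is the
  matrix coefficient of the operator.\<close>

lemma signed_integral_dyadic_op:
  "signed_integral (restrict_space borel X) (\<lambda>A. inner (blinfun_apply (F A) g) h)
     (\<lambda>x. complex_of_real (\<phi> x)) =
   complex_of_real (inner (blinfun_apply (dyadic_op X F a b \<phi>) g) h)"
proof -
  let ?M = "restrict_space borel X" and ?\<mu> = "\<lambda>A. inner (blinfun_apply (F A) g) h"
  let ?N = "\<lambda>u. spectral_measure X F ((1/2) *\<^sub>R u)"
  define U where "U = upper_variation ?M ?\<mu>"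
  define L where "L = upper_variation ?M (\<lambda>A. - ?\<mu> A)"
  have \<mu>: "?\<mu> A = measure (?N (g + h)) A - measure (?N (g - h)) A" if "A \<in> borel_sets_on X" for A
    unfolding measure_spectral_measure[OF F that]
    by (rule orth_projections_polarization[OF pvms_projection[OF F that]])
  have J: "finite_measure U" "finite_measure L" "sets U = borel_sets_on X" "sets L = borel_sets_on X"
    "\<And>A. A \<in> borel_sets_on X \<Longrightarrow> measure U A - measure L A = ?\<mu> A"
    unfolding U_def L_def
    by (rule Jordan_decomposition_upper_variation[OF finite_spectral_measure[OF F]
          finite_spectral_measure[OF F] sets_spectral_measure sets_spectral_measure \<mu>]; assumption)+
  have "(\<integral>x. \<phi> x \<partial>U) - (\<integral>x. \<phi> x \<partial>L) =
      a * (measure U X - measure L X) +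
      (b - a) * ((\<Sum>k. (1/2) ^ Suc k * measure U (D k)) - (\<Sum>k. (1/2) ^ Suc k * measure L (D k)))"
    unfolding integral_eq_digits(1)[OF J(1,3)] integral_eq_digits(1)[OF J(2,4)]
    unfolding right_diff_distrib[of a] right_diff_distrib[of "b - a"] by (rule add_diff_add)
  also have "(\<Sum>k. (1/2) ^ Suc k * measure U (D k)) - (\<Sum>k. (1/2) ^ Suc k * measure L (D k)) =
      (\<Sum>k. (1/2) ^ Suc k * measure U (D k) - (1/2) ^ Suc k * measure L (D k))"
    by (rule suminf_diff[OF integral_eq_digits(2)[OF J(1,3)] integral_eq_digits(2)[OF J(2,4)]])
  also have "\<dots> = (\<Sum>k. (1/2) ^ Suc k *\<^sub>R ?\<mu> (D k))"
    by (intro suminf_cong)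
      (simp add: J(5)[OF digit_set_borel, symmetric] right_diff_distrib del: power_Suc)
  also have "measure U X - measure L X = inner g h"
    using J(5)[of X] by (simp add: pvms_space[OF F])
  also have "a * inner g h + (b - a) * (\<Sum>k. (1/2) ^ Suc k *\<^sub>R ?\<mu> (D k)) =
      inner (blinfun_apply (dyadic_op X F a b \<phi>) g) h"
    using bounded_linear_dyadic_op(1)[OF bounded_linear_apply_inner, of g h] by simp
  finally have "(\<integral>x. \<phi> x \<partial>U) - (\<integral>x. \<phi> x \<partial>L) = inner (blinfun_apply (dyadic_op X F a b \<phi>) g) h" .
  then show ?thesis
    by (simp add: signed_integral_def U_def[symmetric] L_def[symmetric] flip: of_real_diff)
qed

text \<open>The real and imaginary parts of the complex measure are the signed measures for
  \<open>h\<close> and for \<open>cscale \<i> h\<close>.\<close>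

lemma complex_integral_dyadic_op:
  "complex_integral (restrict_space borel X) (\<lambda>A. cinner (blinfun_apply (F A) g) h)
     (\<lambda>x. complex_of_real (\<phi> x)) =
   cinner (blinfun_apply (dyadic_op X F a b \<phi>) g) h"
proof -
  have "Re (cinner u v) = inner u v" "Im (cinner u v) = inner u (cscale \<i> v)" for u v
    by (subst cinner_eq_inner, simp)+
  then show ?thesis
    unfolding complex_integral_def by (simp only: signed_integral_dyadic_op flip: cinner_eq_inner)
qed

text \<open>Each \<open>F (D k)\<close> commutes with complex scalars; pairing with \<open>h\<close>
  lets the scalar be pulled out of a convergent complex series.\<close>

lemma dyadic_op_in_bounded_ops: "dyadic_op X F a b \<phi> \<in> bounded_ops"
  unfolding bounded_ops_def
proof (intro CollectI allI cinner_ext)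
  fix c g h
  let ?T = "dyadic_op X F a b \<phi>"
  have bl: "bounded_linear (\<lambda>T :: L2R \<Rightarrow>\<^sub>L L2R. cinner (blinfun_apply T u) h)" for u
    by (rule bounded_linear_compose[OF bounded_linear_cinner_left blinfun.bounded_linear_left])
  have "F (D k) \<in> bounded_ops" for k
    using pvms_projection[OF F digit_set_borel] by (simp add: orth_projections_def)
  then have comm: "blinfun_apply (F (D k)) (cscale c g) = cscale c (blinfun_apply (F (D k)) g)" for k
    by (simp add: bounded_ops_def)
  have "cinner (blinfun_apply ?T (cscale c g)) h =
      a *\<^sub>R (c * cinner g h) + (b - a) *\<^sub>R (\<Sum>k. (1/2) ^ Suc k *\<^sub>R (c * cinner (blinfun_apply (F (D k)) g) h))"
    by (subst bounded_linear_dyadic_op(1)[OF bl])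
      (simp only: comm cinner_scale_left id_blinfun.rep_eq id_apply)
  also have "(\<Sum>k. (1/2) ^ Suc k *\<^sub>R (c * cinner (blinfun_apply (F (D k)) g) h)) =
      c * (\<Sum>k. (1/2) ^ Suc k *\<^sub>R cinner (blinfun_apply (F (D k)) g) h)"
    by (subst suminf_mult[OF bounded_linear_dyadic_op(2)[OF bl], symmetric])
      (simp only: mult_scaleR_right)
  also have "a *\<^sub>R (c * cinner g h) + (b - a) *\<^sub>R (c * (\<Sum>k. (1/2) ^ Suc k *\<^sub>R cinner (blinfun_apply (F (D k)) g) h))
      = c * cinner (blinfun_apply ?T g) h"
    by (subst bounded_linear_dyadic_op(1)[OF bl])
      (simp only: distrib_left mult_scaleR_right id_blinfun.rep_eq id_apply)
  finally show "cinner (blinfun_apply ?T (cscale c g)) h = cinner (cscale c (blinfun_apply ?T g)) h"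
    by (simp add: cinner_scale_left)
qed

text \<open>The definite description needs existence, which the two preceding lemmas give, and
  uniqueness, which holds because an operator is determined by its matrix coefficients.\<close>

lemma pvm_integral_eq_dyadic_op:
  "pvm_integral X F (\<lambda>x. complex_of_real (\<phi> x)) = dyadic_op X F a b \<phi>"
  unfolding pvm_integral_def complex_integral_dyadic_op
proof (rule the_equality)
  show "dyadic_op X F a b \<phi> \<in> bounded_ops \<and> (\<forall>g h. cinner (blinfun_apply (dyadic_op X F a b \<phi>) g) h =
      cinner (blinfun_apply (dyadic_op X F a b \<phi>) g) h)"
    using dyadic_op_in_bounded_ops by simp
next
  fix T
  assume "T \<in> bounded_ops \<and> (\<forall>g h. cinner (blinfun_apply T g) h =
    cinner (blinfun_apply (dyadic_op X F a b \<phi>) g) h)"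
  then show "T = dyadic_op X F a b \<phi>"
    by (intro blinfun_eqI) (rule cinner_ext, simp)
qed

end

text \<open>The terms \<open>a *\<^sub>R id_blinfun\<close> cancel, and each series has norm at most
  the sum 1 of its weights. The bound depends on the width of the range alone, so adding a constant
  to \<open>\<phi>\<close> does not affect it.\<close>

lemma norm_dyadic_op_diff_le:
  assumes "E \<in> pvms X" "F \<in> pvms X" "\<phi> \<in> borel_measurable (restrict_space borel X)"
    and "\<And>x. x \<in> X \<Longrightarrow> a \<le> \<phi> x \<and> \<phi> x < b" "a < b"
  shows "norm (dyadic_op X E a b \<phi> - dyadic_op X F a b \<phi>) \<le> 2 * (b - a)"
proof -
  have "norm (\<Sum>k. (1/2) ^ Suc k *\<^sub>R G (digit_set X (\<lambda>x. (\<phi> x - a) / (b - a)) k)) \<le> 1"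
    if "G \<in> pvms X" for G
  proof -
    let ?f = "\<lambda>k. (1/2) ^ Suc k *\<^sub>R G (digit_set X (\<lambda>x. (\<phi> x - a) / (b - a)) k)"
    have "norm (suminf ?f) \<le> (\<Sum>k. (1/2) ^ Suc k)"
      using norm_digit_term[OF that assms(3-5)] summable_halves[of 1]
      by (intro norm_suminf_le) simp_all
    also have "(\<Sum>k. (1/2::real) ^ Suc k) = 1"
      using power_half_series by (simp add: sums_iff)
    finally show ?thesis .
  qed
  from add_mono[OF this[OF assms(1)] this[OF assms(2)]]
  have "norm ((\<Sum>k. (1/2) ^ Suc k *\<^sub>R E (digit_set X (\<lambda>x. (\<phi> x - a) / (b - a)) k)) -
      (\<Sum>k. (1/2) ^ Suc k *\<^sub>R F (digit_set X (\<lambda>x. (\<phi> x - a) / (b - a)) k))) \<le> 1 + 1"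
    by (rule norm_triangle_le_diff)
  from mult_left_mono[OF this, of "b - a"] have
    "norm ((b - a) *\<^sub>R ((\<Sum>k. (1/2) ^ Suc k *\<^sub>R E (digit_set X (\<lambda>x. (\<phi> x - a) / (b - a)) k)) -
      (\<Sum>k. (1/2) ^ Suc k *\<^sub>R F (digit_set X (\<lambda>x. (\<phi> x - a) / (b - a)) k)))) \<le> 2 * (b - a)"
    using \<open>a < b\<close> by (simp only: norm_scaleR) simp
  then show ?thesis
    by (simp only: dyadic_op_def add_diff_cancel_left scaleR_diff_right)
qed

section \<open>The metric\<close>

lemma lipschitz_borel_measurable:
  fixes \<phi> :: "'x::metric_space \<Rightarrow> real"
  assumes "1-lipschitz_on X \<phi>"
  shows "\<phi> \<in> borel_measurable (restrict_space borel X)"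
  using assms by (intro borel_measurable_continuous_on_restrict lipschitz_on_continuous_on)

text \<open>The width \<open>r\<close> is common to all \<open>\<phi>\<close>, while
  \<open>a\<close> varies with \<open>\<phi>\<close>; this is what a bound uniform over the
  Lipschitz functions requires.\<close>

lemma bounded_lipschitz_range:
  fixes X :: "'x::metric_space set"
  assumes "bounded X"
  obtains r where "0 < r"
    "\<And>\<phi> :: 'x \<Rightarrow> real. 1-lipschitz_on X \<phi> \<Longrightarrow> \<exists>a. \<forall>x\<in>X. a \<le> \<phi> x \<and> \<phi> x < a + r"
proof (cases "X = {}")
  case True
  then show ?thesis using that[of 1] by simp
next
  case False
  then obtain x0 where x0: "x0 \<in> X" by auto
  obtain e where e: "\<And>x. x \<in> X \<Longrightarrow> dist x0 x \<le> e"
    using assms unfolding bounded_any_center[where a = x0] by blast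
  have "0 \<le> e" using e[OF x0] by simp
  show ?thesis
  \<comment> \<open>The values stay within \<open>e\<close> of \<open>\<phi> x0\<close>; the extra 1
    makes the upper inequality strict and keeps the width positive when
    \<open>e = 0\<close>.\<close>
  proof (rule that[of "2 * e + 1"])
    fix \<phi> :: "'x \<Rightarrow> real" assume \<phi>: "1-lipschitz_on X \<phi>"
    have "\<bar>\<phi> x0 - \<phi> x\<bar> \<le> e" if "x \<in> X" for x
      using lipschitz_onD[OF \<phi> x0 that] e[OF that] by (simp add: dist_real_def)
    then show "\<exists>a. \<forall>x\<in>X. a \<le> \<phi> x \<and> \<phi> x < a + (2 * e + 1)"
      by (intro exI[of _ "\<phi> x0 - e"]) (force simp: abs_le_iff)
  qed (use \<open>0 \<le> e\<close> in simp)
qed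

text \<open>A real \<open>SUP\<close> is an upper bound only if the set is bounded above; here
  \<open>2 * r\<close> bounds all terms at once.\<close>

lemma bdd_above_pvm_integral_diff:
  fixes X :: "'x::metric_space set"
  assumes "bounded X" "E \<in> pvms X" "F \<in> pvms X"
  shows "bdd_above ((\<lambda>\<phi>. norm (pvm_integral X E (\<lambda>x. complex_of_real (\<phi> x)) -
    pvm_integral X F (\<lambda>x. complex_of_real (\<phi> x)))) ` {\<phi>. 1-lipschitz_on X \<phi>})"
proof -
  obtain r where r: "0 < r"
    "\<And>\<phi> :: 'x \<Rightarrow> real. 1-lipschitz_on X \<phi> \<Longrightarrow> \<exists>a. \<forall>x\<in>X. a \<le> \<phi> x \<and> \<phi> x < a + r"
    using bounded_lipschitz_range[OF assms(1)] by blast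
  show ?thesis
  proof (rule bdd_aboveI2)
    fix \<phi> :: "'x \<Rightarrow> real" assume "\<phi> \<in> {\<phi>. 1-lipschitz_on X \<phi>}"
    then have \<phi>: "1-lipschitz_on X \<phi>" by simp
    obtain a where a: "\<And>x. x \<in> X \<Longrightarrow> a \<le> \<phi> x \<and> \<phi> x < a + r"
      using r(2)[OF \<phi>] by blast
    have eq: "pvm_integral X G (\<lambda>x. complex_of_real (\<phi> x)) = dyadic_op X G a (a + r) \<phi>"
      if "G \<in> pvms X" for G
      by (rule pvm_integral_eq_dyadic_op[OF that lipschitz_borel_measurable[OF \<phi>]]) (use a r(1) in auto)
    have "norm (dyadic_op X E a (a + r) \<phi> - dyadic_op X F a (a + r) \<phi>) \<le> 2 * (a + r - a)"
      by (rule norm_dyadic_op_diff_le[OF assms(2,3) lipschitz_borel_measurable[OF \<phi>]])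
        (use a r(1) in auto)
    then show "norm (pvm_integral X E (\<lambda>x. complex_of_real (\<phi> x)) -
        pvm_integral X F (\<lambda>x. complex_of_real (\<phi> x))) \<le> 2 * r"
      by (simp add: eq[OF assms(2)] eq[OF assms(3)])
  qed
qed

text \<open>Shows that the supremum in \<open>pvm_dist\<close> runs over a non-empty family, and
  serves as the test function for non-negativity.\<close>

lemma lipschitz_zero: "1-lipschitz_on X (\<lambda>_ :: 'x::metric_space. 0 :: real)"
  by (rule lipschitz_onI) simp_all

lemma norm_pvm_integral_diff_le_pvm_dist:
  assumes "bounded X" "E \<in> pvms X" "F \<in> pvms X" "1-lipschitz_on X \<phi>"
  shows "norm (pvm_integral X E (\<lambda>x. complex_of_real (\<phi> x)) -
    pvm_integral X F (\<lambda>x. complex_of_real (\<phi> x))) \<le> pvm_dist X E F"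
  unfolding pvm_dist_def using assms
  by (simp add: cSUP_upper[OF _ bdd_above_pvm_integral_diff[OF assms(1-3)]])

lemma pvm_dist_le:
  assumes "E \<in> pvms X" "F \<in> pvms X"
    and "\<And>\<phi>. 1-lipschitz_on X \<phi> \<Longrightarrow> norm (pvm_integral X E (\<lambda>x. complex_of_real (\<phi> x)) -
      pvm_integral X F (\<lambda>x. complex_of_real (\<phi> x))) \<le> c"
  shows "pvm_dist X E F \<le> c"
  unfolding pvm_dist_def using assms lipschitz_zero[of X] by (auto intro!: cSUP_least)

lemma inner_pvm_integral_lipschitz:
  fixes X :: "'x::metric_space set"
  assumes "bounded X" "F \<in> pvms X" "1-lipschitz_on X \<phi>"
  shows "inner (blinfun_apply (pvm_integral X F (\<lambda>x. complex_of_real (\<phi> x))) g) g =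
    (\<integral>x. \<phi> x \<partial>spectral_measure X F g)"
proof -
  obtain r where r: "0 < r"
    "\<And>\<phi> :: 'x \<Rightarrow> real. 1-lipschitz_on X \<phi> \<Longrightarrow> \<exists>a. \<forall>x\<in>X. a \<le> \<phi> x \<and> \<phi> x < a + r"
    using bounded_lipschitz_range[OF assms(1)] by blast
  obtain a where a: "\<And>x. x \<in> X \<Longrightarrow> a \<le> \<phi> x \<and> \<phi> x < a + r"
    using r(2)[OF assms(3)] by blast
  have "pvm_integral X F (\<lambda>x. complex_of_real (\<phi> x)) = dyadic_op X F a (a + r) \<phi>"
    by (rule pvm_integral_eq_dyadic_op[OF assms(2) lipschitz_borel_measurable[OF assms(3)]])
      (use a r(1) in auto)
  moreover have "inner (blinfun_apply (dyadic_op X F a (a + r) \<phi>) g) g =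
      (\<integral>x. \<phi> x \<partial>spectral_measure X F g)"
    by (rule inner_dyadic_op_spectral_measure[OF assms(2) lipschitz_borel_measurable[OF assms(3)]])
      (use a r(1) in auto)
  ultimately show ?thesis by simp
qed

section \<open>Lipschitz functions separate projection-valued measures\<close>

lemma lipschitz_min_infdist:
  "1-lipschitz_on X (\<lambda>x. min c (infdist x C))"
proof (rule lipschitz_onI)
  fix x y
  show "dist (min c (infdist x C)) (min c (infdist y C)) \<le> 1 * dist x y"
    using infdist_triangle_abs[of x C y] by (auto simp: dist_real_def min_def)
qed simp

text \<open>The functions \<open>min 1 (n * infdist x C)\<close> increase to the indicator of the complement of the
  closed set \<open>C\<close>, and dividing them by \<open>n\<close> makes them \<open>1\<close>-Lipschitz.\<close>

lemma integral_min_infdist_tendsto: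
  fixes C :: "'x::metric_space set"
  assumes "finite_measure M" "sets M = borel_sets_on X" "closed C" "C \<noteq> {}"
  shows "(\<lambda>n. real (Suc n) * (\<integral>x. min (1 / real (Suc n)) (infdist x C) \<partial>M))
    \<longlonglongrightarrow> measure M (X - C)"
proof -
  interpret finite_measure M by fact
  have sp: "space M = X"
    using sets_eq_imp_space_eq[OF assms(2)] by (simp add: space_restrict_space)
  have meas: "(\<lambda>x. min c (infdist x C)) \<in> borel_measurable M" for c
    using lipschitz_borel_measurable[OF lipschitz_min_infdist[of X c C]]
      measurable_cong_sets[OF assms(2) refl] by blast
  have XC: "X - C \<in> sets M"
  proof -
    have "X - C = X \<inter> (- C)" by auto
    then show ?thesis
      using assms(2,3) by (auto simp: sets_restrict_space)
  qed
  let ?f = "\<lambda>n x. real (Suc n) * min (1 / real (Suc n)) (infdist x C)"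
  have "(\<lambda>n. \<integral>x. ?f n x \<partial>M) \<longlonglongrightarrow> (\<integral>x. indicat_real (X - C) x \<partial>M)"
  proof (rule integral_dominated_convergence[where w = "\<lambda>_. 1"])
    show "indicat_real (X - C) \<in> borel_measurable M"
      using XC by simp
    show "?f n \<in> borel_measurable M" for n
      by (intro borel_measurable_times borel_measurable_const meas)
    show "AE x in M. (\<lambda>n. ?f n x) \<longlonglongrightarrow> indicat_real (X - C) x"
    proof (rule AE_I2)
      fix x assume x: "x \<in> space M"
      show "(\<lambda>n. ?f n x) \<longlonglongrightarrow> indicat_real (X - C) x"
      proof (cases "x \<in> C")
        case True
        then show ?thesis by simp
      next
        case False
        then have d: "0 < infdist x C"
          using infdist_pos_not_in_closed[OF assms(3,4)] by blast
        obtain N where N: "1 / real (Suc N) < infdist x C"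
          using reals_Archimedean[OF d] by (auto simp: inverse_eq_divide)
        \<comment> \<open>From \<open>N\<close> on the minimum is \<open>1 / real (Suc n)\<close>,
          so the sequence is constantly 1.\<close>
        have "\<forall>\<^sub>F n in sequentially. ?f n x = indicat_real (X - C) x"
          using eventually_ge_at_top[of N]
        proof eventually_elim
          case (elim n)
          then have "1 / real (Suc n) \<le> 1 / real (Suc N)" by (simp add: frac_le)
          with N have "min (1 / real (Suc n)) (infdist x C) = 1 / real (Suc n)" by simp
          then show ?case using False x sp by simp
        qed
        then show ?thesis by (rule tendsto_eventually)
      qed
    qed
    show "AE x in M. norm (?f n x) \<le> 1" for n
    proof (rule AE_I2)
      fix x
      have "real (Suc n) * min (1 / real (Suc n)) (infdist x C) \<le> real (Suc n) * (1 / real (Suc n))"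
        by (intro mult_left_mono) simp_all
      then show "norm (?f n x) \<le> 1"
        by (simp add: infdist_nonneg abs_mult)
    qed
  qed simp
  moreover have "(\<integral>x. indicat_real (X - C) x \<partial>M) = measure M (X - C)"
    using XC sp by (simp add: Int_absorb2 Diff_subset)
  ultimately show ?thesis
    by simp
qed

text \<open>The truncated distance functions determine the spectral measures of
  \<open>X - C\<close>, and the common total mass \<open>inner g g\<close> then those of
  \<open>X \<inter> C\<close>. These relatively closed sets form an intersection-stable generator of
  the Borel sets, and a projection is determined by its quadratic form. Off the Borel sets both
  sides are \<open>undefined\<close>.\<close>

lemma pvms_eqI:
  fixes X :: "'x::metric_space set"
  assumes X: "bounded X" and E: "E \<in> pvms X" and F: "F \<in> pvms X"
    and eq: "\<And>\<phi>. 1-lipschitz_on X \<phi> \<Longrightarrow>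
      pvm_integral X E (\<lambda>x. complex_of_real (\<phi> x)) = pvm_integral X F (\<lambda>x. complex_of_real (\<phi> x))"
  shows "E = F"
proof
  fix A
  show "E A = F A"
  proof (cases "A \<in> borel_sets_on X")
    case False
    then show ?thesis
      using E F by (auto simp: pvms_def PiE_def extensional_def)
  next
    case A: True
    have meas_eq: "spectral_measure X E g = spectral_measure X F g" for g
    proof (rule measure_eqI_generator_eq[where E = "(\<inter>) X ` Collect closed" and \<Omega> = X and A = "\<lambda>_. X"])
      let ?E = "spectral_measure X E g" and ?F = "spectral_measure X F g"
      interpret E: finite_measure ?E by (rule finite_spectral_measure[OF E])
      interpret F: finite_measure ?F by (rule finite_spectral_measure[OF F])
      have XC: "X - C \<in> borel_sets_on X" if "closed C" for C
      proof -
        have "X - C = X \<inter> (- C)" by auto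
        then show ?thesis
          using that by (auto simp: sets_restrict_space)
      qed
      have total: "measure ?E X = measure ?F X"
        by (simp add: measure_spectral_measure E F pvms_space[OF E] pvms_space[OF F])
      show "Int_stable ((\<inter>) X ` Collect closed)"
      proof (rule Int_stableI)
        fix A B assume "A \<in> (\<inter>) X ` Collect closed" "B \<in> (\<inter>) X ` Collect closed"
        then obtain C D where CD: "A = X \<inter> C" "B = X \<inter> D" "closed C" "closed D" by auto
        have "A \<inter> B = X \<inter> (C \<inter> D)" using CD by auto
        then show "A \<inter> B \<in> (\<inter>) X ` Collect closed"
          by (rule image_eqI) (use CD in \<open>simp add: closed_Int\<close>)
      qed
      have "sets (borel :: 'x measure) = sigma_sets UNIV (Collect closed)"
        by (subst borel_eq_closed) simp
      moreover have "(\<inter>) X ` S = {(\<lambda>x. x) -` A \<inter> X |A. A \<in> S}" for S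
        by auto
      then have "(\<inter>) X ` sigma_sets UNIV (Collect closed) = sigma_sets X ((\<inter>) X ` Collect closed)"
        using sigma_sets_vimage_commute[of "\<lambda>x. x" X UNIV "Collect closed"] by simp
      ultimately show "sets ?E = sigma_sets X ((\<inter>) X ` Collect closed)"
        "sets ?F = sigma_sets X ((\<inter>) X ` Collect closed)"
        by (simp_all add: sets_restrict_space)
      show "range (\<lambda>_. X) \<subseteq> (\<inter>) X ` Collect closed"
        by (auto intro!: image_eqI[of _ _ UNIV])
      fix Y assume "Y \<in> (\<inter>) X ` Collect closed"
      then obtain C where C: "closed C" "Y = X \<inter> C" by auto
      show "emeasure ?E Y = emeasure ?F Y"
      \<comment> \<open>By convention \<open>infdist x {}\<close> is 0, so the approximation of the
        complement needs \<open>C\<close> to be non-empty.\<close>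
      proof (cases "C = {}")
        case False
        have "(\<integral>x. min c (infdist x C) \<partial>?E) = (\<integral>x. min c (infdist x C) \<partial>?F)" for c
          using inner_pvm_integral_lipschitz[OF X E lipschitz_min_infdist, of c C g]
            inner_pvm_integral_lipschitz[OF X F lipschitz_min_infdist, of c C g]
            eq[OF lipschitz_min_infdist, of c C] by simp
        then have "measure ?E (X - C) = measure ?F (X - C)"
          using integral_min_infdist_tendsto[OF E.finite_measure_axioms sets_spectral_measure C(1) False]
            integral_min_infdist_tendsto[OF F.finite_measure_axioms sets_spectral_measure C(1) False]
          by (simp add: LIMSEQ_unique)
        moreover have "Y = X - (X - C)" using C by auto
        ultimately have "measure ?E Y = measure ?F Y"
          using XC[OF C(1)] total by (simp add: E.finite_measure_Diff F.finite_measure_Diff)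
        then show ?thesis
          by (simp add: E.emeasure_eq_measure F.emeasure_eq_measure)
      qed (simp add: C)
    qed (auto simp: emeasure_spectral_measure[OF E])
    show ?thesis
    proof (rule orth_projections_eqI[OF pvms_projection[OF E A] pvms_projection[OF F A]])
      show "inner (blinfun_apply (E A) g) g = inner (blinfun_apply (F A) g) g" for g
        using measure_spectral_measure[OF E A, of g] measure_spectral_measure[OF F A, of g] meas_eq
        by simp
    qed
  qed
qed

text \<open>Boundedness of \<open>X\<close> makes every supremum finite, so the axioms follow from
  the operator norm for each \<open>\<phi>\<close>, with separation supplied by
  \<open>pvms_eqI\<close>. Off the carrier the distance is 0, which keeps it non-negative and
  symmetric there.\<close>

lemma Metric_space_pvms:
  fixes X :: "'x::metric_space set"
  assumes X: "bounded X"
  shows "Metric_space (pvms X) (pvm_dist X)"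
proof
  show "0 \<le> pvm_dist X E F" for E F
  proof (cases "E \<in> pvms X \<and> F \<in> pvms X")
    case True
    then show ?thesis
      using order_trans[OF norm_ge_zero norm_pvm_integral_diff_le_pvm_dist[OF X _ _ lipschitz_zero, of E F]]
      by blast
  qed (auto simp: pvm_dist_def)
  show "pvm_dist X E F = pvm_dist X F E" for E F
    unfolding pvm_dist_def by (simp add: norm_minus_commute conj_commute)
  fix E F assume E: "E \<in> pvms X" and F: "F \<in> pvms X"
  show "pvm_dist X E F = 0 \<longleftrightarrow> E = F"
  proof
    assume "pvm_dist X E F = 0"
    then show "E = F"
      using norm_pvm_integral_diff_le_pvm_dist[OF X E F] by (intro pvms_eqI[OF X E F]) fastforce
  next
    assume "E = F"
    then show "pvm_dist X E F = 0"
      using pvm_dist_le[OF E F, of 0] norm_pvm_integral_diff_le_pvm_dist[OF X E F lipschitz_zero] by simp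
  qed
  fix G assume G: "G \<in> pvms X"
  show "pvm_dist X E G \<le> pvm_dist X E F + pvm_dist X F G"
  proof (rule pvm_dist_le[OF E G])
    fix \<phi> :: "'x \<Rightarrow> real" assume \<phi>: "1-lipschitz_on X \<phi>"
    show "norm (pvm_integral X E (\<lambda>x. complex_of_real (\<phi> x)) -
      pvm_integral X G (\<lambda>x. complex_of_real (\<phi> x))) \<le> pvm_dist X E F + pvm_dist X F G"
      using norm_pvm_integral_diff_le_pvm_dist[OF X E F \<phi>] norm_pvm_integral_diff_le_pvm_dist[OF X F G \<phi>]
      by (rule norm_diff_triangle_le)
  qed
qed

section \<open>Non-compactness\<close>

text \<open>Symmetry and idempotence give \<open>inner (p g) (p g) = inner g (p g)\<close>, and
  Cauchy-Schwarz then bounds \<open>p\<close> by 1. Only for a bounded linear map does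
  \<open>Blinfun p\<close> act as \<open>p\<close>.\<close>

lemma linear_projection_in_orth_projections:
  assumes add: "\<And>g h. p (g + h) = p g + p h" and scale: "\<And>c g. p (cscale c g) = cscale c (p g)"
    and idem: "\<And>g. p (p g) = p g" and symm: "\<And>g h. cinner (p g) h = cinner g (p h)"
  shows "Blinfun p \<in> orth_projections" and "blinfun_apply (Blinfun p) = p"
proof -
  have "bounded_linear p"
  proof (rule bounded_linear_intro[of _ 1])
    show "p (r *\<^sub>R g) = r *\<^sub>R p g" for r g by (simp add: scaleR_cscale scale)
    show "norm (p g) \<le> norm g * 1" for g
    proof -
      have "inner (p g) (p g) = inner g (p g)"
        using symm[of g "p g"] by (simp add: inner_L2R_def idem)
      then have "norm (p g) * norm (p g) \<le> norm (p g) * norm g"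
        using norm_cauchy_schwarz[of g "p g"]
        by (simp add: mult.commute flip: power2_norm_eq_inner power2_eq_square)
      then show ?thesis
        by (cases "norm (p g) = 0") (auto dest: mult_left_le_imp_le)
    qed
  qed (rule add)
  then show apply_p: "blinfun_apply (Blinfun p) = p"
    by (rule bounded_linear_Blinfun_apply)
  show "Blinfun p \<in> orth_projections"
    unfolding orth_projections_def bounded_ops_def
    using scale idem symm by (auto simp: apply_p intro!: blinfun_eqI)
qed

section \<open>Orthonormal vectors and rank-one projections\<close>

definition rank_one :: "L2R \<Rightarrow> (L2R \<Rightarrow>\<^sub>L L2R)" where
  "rank_one e = Blinfun (\<lambda>g. cscale (cinner g e) e)"

lemma cscale_add_left: "cscale (c + d) f = cscale c f + cscale d f"
  by (rule cinner_ext) (simp add: cinner_scale_left cinner_add_left distrib_right)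

lemma cscale_cscale: "cscale c (cscale d f) = cscale (c * d) f"
  by (rule cinner_ext) (simp add: cinner_scale_left)

lemma rank_one:
  assumes "cinner e e = 1"
  shows rank_one_projection: "rank_one e \<in> orth_projections"
    and rank_one_apply: "blinfun_apply (rank_one e) g = cscale (cinner g e) e"
proof -
  have *: "cinner (cscale (cinner g e) e) h = cinner g (cscale (cinner h e) e)" for g h
    by (simp add: cinner_scale_left cinner_scale_right mult.commute flip: cinner_commute)
  show "rank_one e \<in> orth_projections" "blinfun_apply (rank_one e) g = cscale (cinner g e) e"
    using linear_projection_in_orth_projections[of "\<lambda>g. cscale (cinner g e) e"] assms *
    by (simp_all add: rank_one_def cinner_add_left cinner_scale_left cscale_add_left cscale_cscale)
qed

text \<open>The indicators of the intervals \<open>[n, n + 1)\<close> have disjoint supports, each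
  of length 1.\<close>

lemma orthonormal_sequence_exists:
  obtains e :: "nat \<Rightarrow> L2R" where "\<And>m n. cinner (e m) (e n) = of_bool (m = n)"
proof
  let ?I = "\<lambda>n x. complex_of_real (indicat_real {real n..<real n + 1} x)"
  have sq: "square_integrable (?I n)" for n
  proof -
    have "(cmod (?I n x))\<^sup>2 = indicat_real {real n..<real n + 1} x" for x
      by (simp add: indicator_def)
    moreover have "?I n \<in> borel_measurable lebesgue"
      by (rule measurable_compose[OF borel_measurable_indicator borel_measurable_of_real]) simp
    ultimately show ?thesis
      by (simp add: square_integrable_def)
  qed
  show "cinner (abs_L2R (?I m)) (abs_L2R (?I n)) = of_bool (m = n)" for m n
  proof -
    have "cinner (abs_L2R (?I m)) (abs_L2R (?I n)) = (\<integral>x. ?I m x * cnj (?I n x) \<partial>lebesgue)"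
      by (simp add: cinner.abs_eq L2_rel_refl sq)
    also have "\<dots> = (\<integral>x. complex_of_real (indicat_real ({real m..<real m + 1} \<inter> {real n..<real n + 1}) x) \<partial>lebesgue)"
      by (intro Bochner_Integration.integral_cong) (auto simp: indicator_def)
    also have "\<dots> = complex_of_real (measure lebesgue ({real m..<real m + 1} \<inter> {real n..<real n + 1}))"
      by (subst integral_complex_of_real) simp
    also have "{real m..<real m + 1} \<inter> {real n..<real n + 1} = (if m = n then {real m..<real m + 1} else {})"
      by auto
    finally show ?thesis by simp
  qed
qed

section \<open>Measures concentrated on two points\<close>

definition two_point_pvm ::
    "'x::topological_space set \<Rightarrow> 'x \<Rightarrow> 'x \<Rightarrow> (L2R \<Rightarrow>\<^sub>L L2R) \<Rightarrow> 'x set \<Rightarrow> (L2R \<Rightarrow>\<^sub>L L2R)" where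
  "two_point_pvm X x y P = restrict
     (\<lambda>A. indicat_real A x *\<^sub>R P + indicat_real A y *\<^sub>R (id_blinfun - P)) (borel_sets_on X)"

lemma orth_projections_complement:
  assumes "P \<in> orth_projections"
  shows "id_blinfun - P \<in> orth_projections"
proof -
  have cscale_diff: "cscale c (f - g) = cscale c f - cscale c g" for c f g
    by transfer (simp add: L2_rel_def right_diff_distrib square_integrable_diff square_integrable_scale)
  have cinner_diff_left: "cinner (f - g) h = cinner f h - cinner g h" for f g h
    using cinner_add_left[of "f - g" g h] by simp
  have cinner_diff_right: "cinner h (f - g) = cinner h f - cinner h g" for f g h
    by (subst (1 2 3) cinner_commute) (simp add: cinner_diff_left)
  show ?thesis
    using assms orth_projections_idem[OF assms]
    by (auto simp: orth_projections_def bounded_ops_def blinfun.diff_left blinfun.diff_right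
        cscale_diff cinner_diff_left cinner_diff_right intro!: blinfun_eqI)
qed

lemma indicator_sums_disjoint:
  assumes "disjoint_family A"
  shows "(\<lambda>n. indicat_real (A n) x) sums indicat_real (\<Union>n. A n) x"
proof (cases "x \<in> (\<Union>n. A n)")
  case True
  then obtain k where k: "x \<in> A k" by auto
  then have "indicat_real (A n) x = (if n = k then 1 else 0)" for n
    using assms by (auto simp: disjoint_family_on_def indicator_def)
  then show ?thesis
    using True sums_single[of k "\<lambda>_. 1::real"] by simp
qed (simp add: indicator_def)

text \<open>The values are \<open>0\<close>, \<open>P\<close>, its complement and the identity, all
  projections. Multiplicativity holds because \<open>P\<close> and its complement are idempotents
  with product 0, and additivity reduces to that of the two point masses.\<close>

lemma two_point_pvm_in_pvms:
  assumes xy: "x \<in> X" "y \<in> X" and P: "P \<in> orth_projections"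
  shows "two_point_pvm X x y P \<in> pvms X"
proof -
  let ?Q = "id_blinfun - P"
  let ?E = "\<lambda>A. indicat_real A x *\<^sub>R P + indicat_real A y *\<^sub>R ?Q"
  have mult: "?E (A \<inter> B) = ?E A o\<^sub>L ?E B" for A B
    using orth_projections_idem[OF P]
    by (intro blinfun_eqI) (auto simp: indicator_def blinfun.bilinear_simps)
  have proj: "?E A \<in> orth_projections" for A
  proof -
    have id: "id_blinfun \<in> orth_projections"
      by (auto simp: orth_projections_def bounded_ops_def intro!: blinfun_eqI)
    \<comment> \<open>Zero is the complement of the identity.\<close>
    have "0 \<in> orth_projections"
      using orth_projections_complement[OF id] by simp
    with id show ?thesis
      using P orth_projections_complement[OF P] by (auto simp: indicator_def)
  qed
  have sums: "(\<lambda>n. blinfun_apply (?E (A n)) g) sums blinfun_apply (?E (\<Union>n. A n)) g"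
    if "disjoint_family A" for A :: "nat \<Rightarrow> 'a set" and g
    unfolding blinfun.add_left blinfun.scaleR_left
    by (intro sums_add bounded_linear.sums[OF bounded_linear_scaleR_left] indicator_sums_disjoint that)
  show ?thesis
    unfolding pvms_def two_point_pvm_def
    using xy sums by (auto simp: proj mult range_subsetD)
qed

text \<open>On each digit set the measure is a combination of \<open>P\<close> and its complement
  with indicator coefficients, so the operator series splits into the binary expansions of the
  normalised values at \<open>x\<close> and at \<open>y\<close>.\<close>

lemma pvm_integral_two_point_pvm:
  fixes X :: "'x::metric_space set"
  assumes "bounded X" "x \<in> X" "y \<in> X" "P \<in> orth_projections" "1-lipschitz_on X \<phi>"
  shows "pvm_integral X (two_point_pvm X x y P) (\<lambda>z. complex_of_real (\<phi> z)) =
    \<phi> x *\<^sub>R P + \<phi> y *\<^sub>R (id_blinfun - P)"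
proof -
  let ?E = "two_point_pvm X x y P" and ?Q = "id_blinfun - P"
  have E: "?E \<in> pvms X" by (rule two_point_pvm_in_pvms) fact+
  obtain r where r: "0 < r"
    "\<And>\<phi> :: 'x \<Rightarrow> real. 1-lipschitz_on X \<phi> \<Longrightarrow> \<exists>a. \<forall>x\<in>X. a \<le> \<phi> x \<and> \<phi> x < a + r"
    using bounded_lipschitz_range[OF assms(1)] by blast
  obtain a where a: "\<And>x. x \<in> X \<Longrightarrow> a \<le> \<phi> x \<and> \<phi> x < a + r"
    using r(2)[OF assms(5)] by blast
  note meas = lipschitz_borel_measurable[OF assms(5)]
  \<comment> \<open>The divisor \<open>a + r - a\<close> is the width \<open>b - a\<close> in
    \<open>dyadic_op\<close> for \<open>b = a + r\<close>.\<close>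
  let ?D = "digit_set X (\<lambda>x. (\<phi> x - a) / (a + r - a))"
  have eq: "pvm_integral X ?E (\<lambda>x. complex_of_real (\<phi> x)) = dyadic_op X ?E a (a + r) \<phi>"
    by (rule pvm_integral_eq_dyadic_op[OF E meas]) (use a r(1) in auto)
  have D: "?D k \<in> borel_sets_on X" for k
    by (rule digit_set_borel[OF E meas]) (use a r(1) in auto)
  have dig: "(\<lambda>k. (1/2) ^ Suc k * indicat_real (?D k) z) sums ((\<phi> z - a) / (a + r - a))" if "z \<in> X" for z
    by (rule digit_set_sums) (use a[OF that] r(1) that in auto)
  have "(\<lambda>k. ((1/2) ^ Suc k * indicat_real (?D k) x) *\<^sub>R P + ((1/2) ^ Suc k * indicat_real (?D k) y) *\<^sub>R ?Q)
      sums (((\<phi> x - a) / (a + r - a)) *\<^sub>R P + ((\<phi> y - a) / (a + r - a)) *\<^sub>R ?Q)"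
    by (intro sums_add bounded_linear.sums[OF bounded_linear_scaleR_left] dig assms)
  also have "(\<lambda>k. ((1/2) ^ Suc k * indicat_real (?D k) x) *\<^sub>R P + ((1/2) ^ Suc k * indicat_real (?D k) y) *\<^sub>R ?Q)
      = (\<lambda>k. (1/2) ^ Suc k *\<^sub>R ?E (?D k))"
    using D by (simp add: two_point_pvm_def scaleR_add_right)
  finally have "(\<Sum>k. (1/2) ^ Suc k *\<^sub>R ?E (?D k)) =
      ((\<phi> x - a) / r) *\<^sub>R P + ((\<phi> y - a) / r) *\<^sub>R ?Q"
    by (simp add: sums_iff)
  then have "dyadic_op X ?E a (a + r) \<phi> =
      a *\<^sub>R id_blinfun + r *\<^sub>R (((\<phi> x - a) / r) *\<^sub>R P + ((\<phi> y - a) / r) *\<^sub>R ?Q)"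
    by (simp add: dyadic_op_def)
  also have "\<dots> = \<phi> x *\<^sub>R P + \<phi> y *\<^sub>R ?Q"
    using r(1) by (simp add: scaleR_add_right scaleR_diff_left scaleR_diff_right)
  finally show ?thesis by (simp add: eq)
qed

text \<open>The test function \<open>dist z y\<close> vanishes at \<open>y\<close>, so the two
  integrals are \<open>dist x y *\<^sub>R P\<close> and \<open>dist x y *\<^sub>R Q\<close>.\<close>

lemma pvm_dist_two_point_pvm_ge:
  fixes X :: "'x::metric_space set"
  assumes "bounded X" "x \<in> X" "y \<in> X" "P \<in> orth_projections" "Q \<in> orth_projections"
  shows "dist x y * norm (P - Q) \<le> pvm_dist X (two_point_pvm X x y P) (two_point_pvm X x y Q)"
proof -
  have lip: "1-lipschitz_on X (\<lambda>z. dist z y)"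
    using abs_dist_diff_le[of _ y] by (intro lipschitz_onI) (simp_all add: dist_real_def dist_commute)
  have "dist x y *\<^sub>R P - dist x y *\<^sub>R Q = dist x y *\<^sub>R (P - Q)"
    by (simp add: scaleR_diff_right)
  then show ?thesis
    using norm_pvm_integral_diff_le_pvm_dist[OF assms(1) two_point_pvm_in_pvms[OF assms(2-4)]
        two_point_pvm_in_pvms[OF assms(2,3,5)] lip]
    by (simp add: pvm_integral_two_point_pvm[OF assms(1-4) lip] pvm_integral_two_point_pvm[OF assms(1-3,5) lip])
qed

lemma not_compact_space_pvms:
  fixes X :: "'x::metric_space set"
  assumes X: "bounded X" "x \<in> X" "y \<in> X" "x \<noteq> y"
  shows "\<not> compact_space (Metric_space.mtopology (pvms X) (pvm_dist X))"
proof
  interpret Metric_space "pvms X" "pvm_dist X" by (rule Metric_space_pvms[OF X(1)])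
  assume "compact_space mtopology"
  obtain e :: "nat \<Rightarrow> L2R" where e: "\<And>m n. cinner (e m) (e n) = of_bool (m = n)"
    using orthonormal_sequence_exists by blast
  define \<sigma> where "\<sigma> n = two_point_pvm X x y (rank_one (e n))" for n
  have proj: "rank_one (e n) \<in> orth_projections" for n
    by (rule rank_one_projection) (simp add: e)
  have far: "dist x y \<le> pvm_dist X (\<sigma> m) (\<sigma> n)" if "m \<noteq> n" for m n
  proof -
    have "norm (e m) = 1" by (simp add: norm_L2R_def e)
    \<comment> \<open>The unit vector \<open>e m\<close> is fixed by its own projection and
      annihilated by the other, so the difference has norm at least 1.\<close>
    moreover have "blinfun_apply (rank_one (e m) - rank_one (e n)) (e m) = e m"
    proof -
      have "cscale 1 f = f" "cscale 0 f = 0" for f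
        by (rule cinner_ext, simp add: cinner_scale_left
            linear_0[OF bounded_linear.linear[OF bounded_linear_cinner_left]])+
      then show ?thesis
        using that by (simp add: blinfun.diff_left rank_one_apply e)
    qed
    ultimately have "1 \<le> norm (rank_one (e m) - rank_one (e n))"
      using norm_blinfun[of "rank_one (e m) - rank_one (e n)" "e m"] by simp
    then have "dist x y \<le> dist x y * norm (rank_one (e m) - rank_one (e n))"
      by (simp add: mult_le_cancel_left1)
    then show ?thesis
      using pvm_dist_two_point_pvm_ge[OF X(1-3) proj proj, of m n] by (simp add: \<sigma>_def)
  qed
  have "range \<sigma> \<subseteq> pvms X"
    using two_point_pvm_in_pvms[OF X(2,3) proj] by (auto simp: \<sigma>_def)
  then obtain l s where l: "l \<in> pvms X" "strict_mono s" "limitin mtopology (\<sigma> \<circ> s) l sequentially"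
    using \<open>compact_space mtopology\<close> unfolding compact_space_sequentially by meson
  have "MCauchy (\<sigma> \<circ> s)"
    using l(3) \<open>range \<sigma> \<subseteq> pvms X\<close> by (intro convergent_imp_MCauchy) auto
  then obtain N where "\<And>m n. N \<le> m \<Longrightarrow> N \<le> n \<Longrightarrow> pvm_dist X ((\<sigma> \<circ> s) m) ((\<sigma> \<circ> s) n) < dist x y"
    using \<open>x \<noteq> y\<close> unfolding MCauchy_def by (meson zero_less_dist_iff)
  \<comment> \<open>Strict monotonicity of \<open>s\<close> makes the two indices distinct, so
    \<open>far\<close> applies to neighbours in the subsequence.\<close>
  from this[of N "Suc N"] far[of "s N" "s (Suc N)"] strict_monoD[OF l(2), of N "Suc N"]
  show False by simp
qed

text \<open>The closed disc is bounded and contains the distinct points \<open>0\<close> and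
  \<open>1\<close>. The first conjunct ensures that the topology in the second is the one induced by
  a genuine metric.\<close>

theorem mainTheorem5:
  shows "Metric_space (pvms (cball (0::complex) 1)) (pvm_dist (cball (0::complex) 1)) \<and>
    \<not> compact_space
      (Metric_space.mtopology (pvms (cball (0::complex) 1)) (pvm_dist (cball (0::complex) 1)))"
  using Metric_space_pvms[OF bounded_cball]
    not_compact_space_pvms[OF bounded_cball, of 0 "0::complex" 1 1] by simp

end
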